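(* Let $d_X,d_Y\in\mathbb{N}$, $s_X,s_Y,r>0$, $A\in[1,\infty)$, and let $d:=d_X+d_Y$ and $s:=d/(d_X/s_X+d_Y/s_Y)$. Let $\mathcal{X}=[0,1]^{d_X}$ and $\mathcal{Y}=[0,1]^{d_Y}$ with Lebesgue measures and the Fourier basis functions and Sobolev weights $\theta$ described in the context, and let $\xi=(\theta,r,A)$. Fix $\gamma\in(0,1)$. Then there exist $c_1,c_2\in(0,\infty)$, each depending only on $d_X,d_Y,\gamma,s_X,s_Y$ and $A$, such that if $nr^2\ge2$ and $(r^d/n^{2s})^{1/(4s+d)}\le c_1/\log^{1/2}(nr^2)$, then $$\tilde\rho^*(n,\gamma,\xi)\ge c_2\biggl(\frac{r^d}{n^{2s}}\biggr)^{1/(4s+d)}.$$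
   Context: $n\in\mathbb{N}$ is the sample size and $\mathbb{N}_0=\{0,1,2,\ldots\}$. $\mathcal{X}=[0,1]^{d_X}$ and $\mathcal{Y}=[0,1]^{d_Y}$ carry Lebesgue measures $\mu_X,\mu_Y$; $\mu:=\mu_X\otimes\mu_Y$. Index sets: $\mathcal{J}:=\{(a,m):a\in\{0,1\},m\in\mathbb{N}_0^{d_X}\}\setminus\{(1,0)\}$, $\mathcal{K}:=\{(a,m):a\in\{0,1\},m\in\mathbb{N}_0^{d_Y}\}\setminus\{(1,0)\}$. Orthonormal Fourier basis functions: $p_{0,0}^X:=1$ and, for $m=(m_1,\ldots,m_{d_X})\ne0$, $$p_{a,m}^X(x_1,\ldots,x_{d_X}):=2^{1/2}\mathrm{Re}\Bigl(e^{-a\pi i/2}\prod_{\ell=1}^{d_X}e^{-2\pi im_\ell x_\ell}\Bigr);$$ $p_{a,m}^Y$ is defined in the same way with $d_Y$ in place of $d_X$. Put $p_{jk}(x,y):=p_j^X(x)p_k^Y(y)$, $j_0=(0,0)$, $k_0=(0,0)$, so $p_{j_0k_0}=1$. Weights: for $j=(a_X,m_X)$ and $k=(a_Y,m_Y)$, $\theta_{jk}:=\|m_X\|_1^{s_X}\vee\|m_Y\|_1^{s_Y}$ if $j\ne j_0$ and $k\ne k_0$, and (by convention, since these terms do not contribute to $S_\theta$ below) $\theta_{jk}:=\infty$ if $j=j_0$ or $k=k_0$; $\|\cdot\|_1$ is the $\ell_1$ norm. $\mathcal{F}$ is the set of probability densities $f\in L^2(\mu)$ on $\mathcal{X}\times\mathcal{Y}$,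 with marginal densities $f_X,f_Y$. $a_{jk}(f):=\int fp_{jk}\,d\mu$, $a_{j\bullet}(f):=\int f_Xp_j^X\,d\mu_X$, $a_{\bullet k}(f):=\int f_Yp_k^Y\,d\mu_Y$, $$D(f):=\int\{f(x,y)-f_X(x)f_Y(y)\}^2\,d\mu(x,y),\qquad S_\theta(f):=\sum_{j,k}\theta_{jk}^2\{a_{jk}(f)-a_{j\bullet}(f)a_{\bullet k}(f)\}^2$$ (with $\infty\cdot0=0$), and for $\rho>0$ $$\mathcal{F}_\xi(\rho):=\{f\in\mathcal{F}:D(f)\ge\rho^2,\ S_\theta(f)\le r^2,\ \max(\|f\|_\infty,\|f_X\|_\infty,\|f_Y\|_\infty)\le A\},$$ where $\|\cdot\|_\infty$ is the supremum norm. Let $\Psi$ be the set of all measurable $\psi:(\mathcal{X}\times\mathcal{Y})^n\to[0,1]$, and $\mathbb{E}_f(\psi)$ the expectation of $\psi(X_1,Y_1,\ldots,X_n,Y_n)$ when the pairs are i.i.d. with density $f$. Define $$\tilde{\mathcal{R}}(n,\xi,\rho):=\inf_{\psi\in\Psi}\Bigl\{\mathbb{E}_{p_{j_0k_0}}(\psi)+\sup_{f\in\mathcal{F}_\xi(\rho)}\mathbb{E}_f(1-\psi)\Bigr\},\qquad\tilde\rho^*(n,\gamma,\xi):=\inf\{\rho>0:\tilde{\mathcal{R}}(n,\xi,\rho)\le\gamma\},$$ with the supremum over an empty class equal to $0$.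
   Formalization: A is required to be greater than 1 instead of A ∈ [1,∞): for A = 1 every density bounded by 1 equals 1 almost everywhere, so F_ξ(ρ) is empty, the separation radius is 0, and the claimed positive lower bound fails (for example r = 1, n large). *)

theory Defs
  imports "HOL-Probability.Probability"
begin

definition unit_cube :: "(real ^ 'd::finite) set" where
  "unit_cube = {x. \<forall>l. 0 \<le> x $ l \<and> x $ l \<le> 1}"

definition cube_measure :: "(real ^ 'd::finite) measure" where
  "cube_measure = restrict_space lborel unit_cube"

definition mu :: "((real ^ 'dx::finite) \<times> (real ^ 'dy::finite)) measure" where
  "mu = cube_measure \<Otimes>\<^sub>M cube_measure"

text \<open>An index is a pair \<open>(a, m)\<close> with \<open>a \<in> {0, 1}\<close>; only pairs in \<open>index_set\<close> are used.\<close>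

type_synonym 'd index = "nat \<times> (nat ^ 'd)"

definition index_set :: "('d::finite) index set" where
  "index_set = ({0, 1} \<times> UNIV) - {(1, 0)}"

definition fourier_basis :: "('d::finite) index \<Rightarrow> real ^ 'd \<Rightarrow> real" where
  "fourier_basis j x =
     (case j of (a, m) \<Rightarrow>
        if m = 0 then 1
        else sqrt 2 * Re (exp (- (of_nat a * of_real pi * \<i> / 2)) *
               (\<Prod>l\<in>UNIV. exp (- (2 * of_real pi * \<i> * of_nat (m $ l) * of_real (x $ l))))))"

definition tensor_basis ::
  "('dx::finite) index \<Rightarrow> ('dy::finite) index \<Rightarrow> (real ^ 'dx) \<times> (real ^ 'dy) \<Rightarrow> real" where
  "tensor_basis j k z = fourier_basis j (fst z) * fourier_basis k (snd z)"

definition l1_norm :: "nat ^ ('d::finite) \<Rightarrow> real" where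
  "l1_norm m = (\<Sum>l\<in>UNIV. real (m $ l))"

definition sobolev_weight ::
  "real \<Rightarrow> real \<Rightarrow> ('dx::finite) index \<Rightarrow> ('dy::finite) index \<Rightarrow> ennreal" where
  "sobolev_weight sX sY j k =
     (if j = (0, 0) \<or> k = (0, 0) then \<infinity>
      else ennreal (max (l1_norm (snd j) powr sX) (l1_norm (snd k) powr sY)))"

definition densities :: "((real ^ 'dx::finite) \<times> (real ^ 'dy::finite) \<Rightarrow> real) set" where
  "densities = {f. f \<in> borel_measurable mu \<and> (\<forall>z\<in>space mu. 0 \<le> f z) \<and>
     (\<integral>\<^sup>+ z. ennreal (f z) \<partial>mu) = 1 \<and> integrable mu (\<lambda>z. (f z)\<^sup>2)}"

definition marginal_X ::
  "((real ^ 'dx::finite) \<times> (real ^ 'dy::finite) \<Rightarrow> real) \<Rightarrow> real ^ 'dx \<Rightarrow> real" where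
  "marginal_X f x = (\<integral>y. f (x, y) \<partial>cube_measure)"

definition marginal_Y ::
  "((real ^ 'dx::finite) \<times> (real ^ 'dy::finite) \<Rightarrow> real) \<Rightarrow> real ^ 'dy \<Rightarrow> real" where
  "marginal_Y f y = (\<integral>x. f (x, y) \<partial>cube_measure)"

definition coef ::
  "((real ^ 'dx::finite) \<times> (real ^ 'dy::finite) \<Rightarrow> real) \<Rightarrow> 'dx index \<Rightarrow> 'dy index \<Rightarrow> real" where
  "coef f j k = (\<integral>z. f z * tensor_basis j k z \<partial>mu)"

definition coef_X ::
  "((real ^ 'dx::finite) \<times> (real ^ 'dy::finite) \<Rightarrow> real) \<Rightarrow> 'dx index \<Rightarrow> real" where
  "coef_X f j = (\<integral>x. marginal_X f x * fourier_basis j x \<partial>cube_measure)"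

definition coef_Y ::
  "((real ^ 'dx::finite) \<times> (real ^ 'dy::finite) \<Rightarrow> real) \<Rightarrow> 'dy index \<Rightarrow> real" where
  "coef_Y f k = (\<integral>y. marginal_Y f y * fourier_basis k y \<partial>cube_measure)"

definition dependence :: "((real ^ 'dx::finite) \<times> (real ^ 'dy::finite) \<Rightarrow> real) \<Rightarrow> real" where
  "dependence f = (\<integral>z. (f z - marginal_X f (fst z) * marginal_Y f (snd z))\<^sup>2 \<partial>mu)"

text \<open>In \<^typ>\<open>ennreal\<close>, \<open>\<infinity> * 0 = 0\<close>, as the convention on infinite weights requires.\<close>

definition smoothness ::
  "(('dx::finite) index \<Rightarrow> ('dy::finite) index \<Rightarrow> ennreal) \<Rightarrow>
     ((real ^ 'dx) \<times> (real ^ 'dy) \<Rightarrow> real) \<Rightarrow> ennreal" where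
  "smoothness \<theta> f =
     (\<Sum>\<^sub>\<infinity>(j, k)\<in>index_set \<times> index_set.
        (\<theta> j k)\<^sup>2 * ennreal ((coef f j k - coef_X f j * coef_Y f k)\<^sup>2))"

definition sup_norm_on :: "'a set \<Rightarrow> ('a \<Rightarrow> real) \<Rightarrow> ennreal" where
  "sup_norm_on S f = (SUP x\<in>S. ennreal \<bar>f x\<bar>)"

text \<open>For \<open>A = 1\<close> this class is empty for every \<open>\<rho> > 0\<close>: a density on the unit cube that is
  bounded by 1 equals 1 almost everywhere, so that \<open>dependence f = 0\<close>.\<close>

definition alternatives ::
  "(('dx::finite) index \<Rightarrow> ('dy::finite) index \<Rightarrow> ennreal) \<Rightarrow> real \<Rightarrow> real \<Rightarrow> real \<Rightarrow>
     ((real ^ 'dx) \<times> (real ^ 'dy) \<Rightarrow> real) set" where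
  "alternatives \<theta> r A \<rho> = {f \<in> densities.
     \<rho>\<^sup>2 \<le> dependence f \<and> smoothness \<theta> f \<le> ennreal (r\<^sup>2) \<and>
     Max {sup_norm_on (unit_cube \<times> unit_cube) f,
          sup_norm_on unit_cube (marginal_X f),
          sup_norm_on unit_cube (marginal_Y f)} \<le> ennreal A}"

definition tests ::
  "nat \<Rightarrow> ((nat \<Rightarrow> (real ^ 'dx::finite) \<times> (real ^ 'dy::finite)) \<Rightarrow> real) set" where
  "tests n = {\<psi> \<in> borel_measurable (Pi\<^sub>M {..<n} (\<lambda>_. mu)).
     \<forall>\<omega>\<in>space (Pi\<^sub>M {..<n} (\<lambda>_. mu)). 0 \<le> \<psi> \<omega> \<and> \<psi> \<omega> \<le> 1}"

definition expect ::
  "nat \<Rightarrow> ((real ^ 'dx::finite) \<times> (real ^ 'dy::finite) \<Rightarrow> real) \<Rightarrow>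
     ((nat \<Rightarrow> (real ^ 'dx) \<times> (real ^ 'dy)) \<Rightarrow> real) \<Rightarrow> real" where
  "expect n f \<psi> = (\<integral>\<omega>. \<psi> \<omega> \<partial>Pi\<^sub>M {..<n} (\<lambda>_. density mu (\<lambda>z. ennreal (f z))))"

text \<open>The supremum is taken in \<^typ>\<open>ennreal\<close>, where the supremum of the empty set is 0.\<close>

definition minimax_risk ::
  "nat \<Rightarrow> (('dx::finite) index \<Rightarrow> ('dy::finite) index \<Rightarrow> ennreal) \<Rightarrow> real \<Rightarrow> real \<Rightarrow> real \<Rightarrow>
     ennreal" where
  "minimax_risk n \<theta> r A \<rho> =
     (INF \<psi>\<in>tests n. ennreal (expect n (tensor_basis (0, 0) (0, 0)) \<psi>) +
        (SUP f\<in>alternatives \<theta> r A \<rho>. ennreal (expect n f (\<lambda>\<omega>. 1 - \<psi> \<omega>))))"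

definition separation_radius ::
  "nat \<Rightarrow> real \<Rightarrow> (('dx::finite) index \<Rightarrow> ('dy::finite) index \<Rightarrow> ennreal) \<Rightarrow> real \<Rightarrow> real \<Rightarrow>
     ennreal" where
  "separation_radius n \<gamma> \<theta> r A =
     Inf (ennreal ` {\<rho>. 0 < \<rho> \<and> minimax_risk n \<theta> r A \<rho> \<le> ennreal \<gamma>})"

end

theory Submission
  imports Defs
begin

text \<open>The bound comes from a random alternative around the uniform density. Let \<open>e\<^sub>i\<close> run through the
  \<open>N\<close> products of a cosine in \<open>x\<close> and a cosine in \<open>y\<close> whose frequencies have all coordinates in
  \<open>{1..KX}\<close> and \<open>{1..KY}\<close>, and put \<open>f\<^sub>\<epsilon> = 1 + \<eta> * (\<Sum>i. \<epsilon>\<^sub>i * e\<^sub>i)\<close> with signs \<open>\<epsilon>\<^sub>i\<close>. No factor is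
  constant, so both marginals of \<open>f\<^sub>\<epsilon>\<close> are uniform and the dependence is carried by the perturbation
  alone: it is \<open>\<eta>\<^sup>2 * N\<close>, and the Sobolev sum is at most \<open>W\<^sup>2 * \<eta>\<^sup>2 * N\<close>, where \<open>W\<close> is the largest weight
  that occurs.

  By orthonormality, the densities for the signs \<open>\<epsilon>\<close> and \<open>\<epsilon>'\<close> have inner product
  \<open>1 + \<eta>\<^sup>2 * (\<Sum>i. \<epsilon>\<^sub>i * \<epsilon>'\<^sub>i)\<close>. The average of its
  \<open>n\<close>-th power over independent uniform signs is at most \<open>exp (n\<^sup>2 * \<eta>\<^sup>4 * N / 2)\<close>
  (\<open>sum_sign_vectors_exp_le\<close>). This average is the second moment of the mixed likelihood ratio, and as long
  as it is close to 1 no test can tell the mixture from the uniform density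
  (\<open>mixture_testing_bound\<close>).

  Not every choice of signs gives a function with values between 0 and \<open>A\<close>. At a single point the perturbation is
  sub-Gaussian with variance proxy \<open>4 * \<eta>\<^sup>2 * N\<close>, and it is Lipschitz, so a union bound over a grid
  controls its supremum (\<open>card_large_signed_perturbations_le\<close>). The size of the grid is polynomial in
  \<open>n * r\<^sup>2\<close>, which costs a factor \<open>log (n * r\<^sup>2)\<close>. The hypothesis on the rate pays exactly for this factor.
  The remaining signs are so numerous that restricting the mixture to them hardly changes the second
  moment (\<open>minimax_risk_lower_bound\<close>).

  It remains to balance the parameters. With \<open>T = (n * r\<^sup>2) powr (2 * s / (4 * s + d))\<close> the rate \<open>R\<close> of the
  theorem satisfies \<open>R * T = r\<close> and \<open>n\<^sup>2 * R ^ 4 = T powr (d / s)\<close> (\<open>rate_identities\<close>). Taking \<open>KX\<close> and \<open>KY\<close>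
  of the order of \<open>T powr (1 / sX)\<close> and \<open>T powr (1 / sY)\<close> makes \<open>W\<close> of order \<open>T\<close> and \<open>N\<close> at least
  \<open>T powr (d / s)\<close>. Then \<open>\<eta>\<^sup>2 * N = (c * R)\<^sup>2\<close> with a small constant \<open>c\<close> satisfies the Sobolev constraint and
  keeps \<open>n\<^sup>2 * \<eta>\<^sup>4 * N\<close> at most \<open>c ^ 4\<close>.\<close>

section \<open>Rademacher sums\<close>

text \<open>Both sides are power series in \<open>x\<^sup>2\<close>, and \<open>2 ^ n * fact n \<le> fact (2 * n)\<close> compares them term by term.\<close>

lemma cosh_le_exp_half_square: "cosh x \<le> exp (x\<^sup>2 / 2)" for x :: real
proof -
  let ?c = "\<lambda>n. if even n then x ^ n / fact n else 0"
  have "?c sums cosh x"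
  proof -
    have "?c = (\<lambda>n. if even n then x ^ n /\<^sub>R fact n else 0)" by (auto simp: divide_inverse)
    then show ?thesis using cosh_converges[of x] by (simp only:)
  qed
  moreover have "(\<lambda>n. ?c (2 * n)) sums s \<longleftrightarrow> ?c sums s" for s
    by (rule sums_mono_reindex[where g = "(*) 2" and f = ?c]) (auto simp: strict_mono_def elim!: evenE)
  ultimately have 1: "(\<lambda>n. x ^ (2 * n) / fact (2 * n)) sums cosh x" by simp
  have 2: "(\<lambda>n. (x\<^sup>2 / 2) ^ n / fact n) sums exp (x\<^sup>2 / 2)"
  proof -
    have "y ^ n / fact n = y ^ n /\<^sub>R fact n" for y :: real and n by (simp add: divide_inverse)
    then show ?thesis using exp_converges[of "x\<^sup>2 / 2"] by (simp only:)
  qed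
  have 3: "x ^ (2 * n) / fact (2 * n) \<le> (x\<^sup>2 / 2) ^ n / fact n" for n
  proof -
    have f: "2 ^ n * fact n \<le> (fact (2 * n) :: real)" for n
    proof (induction n)
      case (Suc n)
      have "2 ^ Suc n * fact (Suc n) = (2 * real n + 2) * (2 ^ n * fact n :: real)" by simp
      also have "\<dots> \<le> (2 * real n + 2) * fact (2 * n)" by (intro mult_left_mono Suc.IH) auto
      also have "\<dots> \<le> (2 * real n + 2) * ((2 * real n + 1) * fact (2 * n))"
        by (intro mult_left_mono) (auto simp: mult_le_cancel_right1)
      also have "\<dots> = fact (2 * Suc n)" by (simp add: algebra_simps)
      finally show ?case .
    qed simp
    have "x ^ (2 * n) / fact (2 * n) = (x\<^sup>2) ^ n / fact (2 * n)" by (simp add: power_mult)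
    also have "\<dots> \<le> (x\<^sup>2) ^ n / (2 ^ n * fact n)" by (intro divide_left_mono f) auto
    finally show ?thesis by (simp add: power_divide)
  qed
  show ?thesis using 3 1 2 by (rule sums_le)
qed

text \<open>Extensional functions, so that only the values on \<open>I\<close> matter and there are finitely many of them.\<close>

definition sign_vectors :: "'i set \<Rightarrow> ('i \<Rightarrow> real) set" where
  "sign_vectors I = I \<rightarrow>\<^sub>E {-1, 1}"

lemma finite_sign_vectors [simp]: "finite I \<Longrightarrow> finite (sign_vectors I)"
  by (simp add: sign_vectors_def finite_PiE)

lemma card_sign_vectors: "finite I \<Longrightarrow> card (sign_vectors I) = 2 ^ card I"
  by (simp add: sign_vectors_def card_PiE numeral_2_eq_2)

lemma abs_sign_vectors: "\<epsilon> \<in> sign_vectors I \<Longrightarrow> i \<in> I \<Longrightarrow> \<bar>\<epsilon> i\<bar> = 1"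
  by (auto simp: sign_vectors_def PiE_iff)

text \<open>This is the moment generating function of a Rademacher sum. It serves twice: for the second
  moment of the mixed likelihood ratio and, through Chernoff's bound, for the supremum of the perturbation.\<close>

lemma sum_sign_vectors_exp_le:
  assumes "finite I"
  shows "(\<Sum>\<epsilon>\<in>sign_vectors I. exp (\<Sum>i\<in>I. \<epsilon> i * b i)) \<le> 2 ^ card I * exp ((\<Sum>i\<in>I. (b i)\<^sup>2) / 2)"
proof -
  have "(\<Sum>\<epsilon>\<in>sign_vectors I. exp (\<Sum>i\<in>I. \<epsilon> i * b i))
      = (\<Sum>\<epsilon>\<in>I \<rightarrow>\<^sub>E {-1, 1}. \<Prod>i\<in>I. exp (\<epsilon> i * b i))"
    using assms by (simp add: exp_sum sign_vectors_def)
  also have "\<dots> = (\<Prod>i\<in>I. \<Sum>t\<in>{-1, 1}. exp (t * b i))"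
    using assms by (subst prod_sum_PiE) auto
  also have "\<dots> = (\<Prod>i\<in>I. 2 * cosh (b i))" by (simp add: cosh_field_def add.commute add_divide_distrib)
  also have "\<dots> \<le> (\<Prod>i\<in>I. 2 * exp ((b i)\<^sup>2 / 2))"
    by (intro prod_mono) (auto simp: cosh_le_exp_half_square)
  also have "\<dots> = 2 ^ card I * exp ((\<Sum>i\<in>I. (b i)\<^sup>2) / 2)"
    using assms by (simp add: prod.distrib exp_sum sum_divide_distrib)
  finally show ?thesis .
qed

text \<open>Hoeffding's inequality for Rademacher sums, as a count of sign vectors.\<close>

lemma card_sign_vectors_large_le:
  assumes "finite I" "0 < v" "(\<Sum>i\<in>I. (b i)\<^sup>2) \<le> v" "0 \<le> t"
  shows "real (card {\<epsilon> \<in> sign_vectors I. t < \<bar>\<Sum>i\<in>I. \<epsilon> i * b i\<bar>}) \<le> 2 * 2 ^ card I * exp (- t\<^sup>2 / (2 * v))"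
proof -
  have one: "real (card {\<epsilon> \<in> sign_vectors I. t < (\<Sum>i\<in>I. \<epsilon> i * b i)}) \<le> 2 ^ card I * exp (- t\<^sup>2 / (2 * v))"
    if b: "(\<Sum>i\<in>I. (b i)\<^sup>2) \<le> v" for b
  proof -
    \<comment> \<open>\<open>t / v\<close> is the value of \<open>l\<close> that minimises \<open>v * l\<^sup>2 / 2 - l * t\<close>\<close>
    let ?l = "t / v"
    let ?B = "{\<epsilon> \<in> sign_vectors I. t < (\<Sum>i\<in>I. \<epsilon> i * b i)}"
    have "real (card ?B) * exp (?l * t) = (\<Sum>\<epsilon>\<in>?B. exp (?l * t))" by simp
    also have "\<dots> \<le> (\<Sum>\<epsilon>\<in>?B. exp (?l * (\<Sum>i\<in>I. \<epsilon> i * b i)))"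
      using assms by (intro sum_mono) (auto intro!: divide_right_mono mult_left_mono)
    also have "\<dots> \<le> (\<Sum>\<epsilon>\<in>sign_vectors I. exp (?l * (\<Sum>i\<in>I. \<epsilon> i * b i)))"
      using assms by (intro sum_mono2) auto
    also have "\<dots> = (\<Sum>\<epsilon>\<in>sign_vectors I. exp (\<Sum>i\<in>I. \<epsilon> i * (?l * b i)))"
      by (simp add: sum_distrib_left mult_ac)
    also have "\<dots> \<le> 2 ^ card I * exp ((\<Sum>i\<in>I. (?l * b i)\<^sup>2) / 2)"
      using assms by (intro sum_sign_vectors_exp_le) auto
    also have "(\<Sum>i\<in>I. (?l * b i)\<^sup>2) \<le> ?l\<^sup>2 * v"
      using b by (simp only: power_mult_distrib sum_distrib_left[symmetric] mult_left_mono zero_le_power2)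
    finally have "real (card ?B) * exp (?l * t) \<le> 2 ^ card I * exp (?l\<^sup>2 * v / 2)"
      by simp
    then have "real (card ?B) \<le> 2 ^ card I * (exp (?l\<^sup>2 * v / 2) / exp (?l * t))"
      by (simp add: pos_le_divide_eq)
    also have "exp (?l\<^sup>2 * v / 2) / exp (?l * t) = exp (- t\<^sup>2 / (2 * v))"
      using assms by (simp add: exp_diff[symmetric] power2_eq_square field_simps)
    finally show ?thesis .
  qed
  have "{\<epsilon> \<in> sign_vectors I. t < \<bar>\<Sum>i\<in>I. \<epsilon> i * b i\<bar>}
      = {\<epsilon> \<in> sign_vectors I. t < (\<Sum>i\<in>I. \<epsilon> i * b i)} \<union> {\<epsilon> \<in> sign_vectors I. t < (\<Sum>i\<in>I. \<epsilon> i * - b i)}"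
    by (auto simp: sum_negf)
  then have "card {\<epsilon> \<in> sign_vectors I. t < \<bar>\<Sum>i\<in>I. \<epsilon> i * b i\<bar>}
      \<le> card {\<epsilon> \<in> sign_vectors I. t < (\<Sum>i\<in>I. \<epsilon> i * b i)} + card {\<epsilon> \<in> sign_vectors I. t < (\<Sum>i\<in>I. \<epsilon> i * - b i)}"
    by (simp add: card_Un_le)
  then show ?thesis
    using one[of b] one[of "\<lambda>i. - b i"] assms by simp
qed

section \<open>Testing against a mixture\<close>

context prob_space
begin

lemma PiM_density:
  assumes [measurable]: "f \<in> borel_measurable M" and nn: "\<And>z. z \<in> space M \<Longrightarrow> 0 \<le> f z"
    and "finite I" and "prob_space (density M (\<lambda>z. ennreal (f z)))"
  shows "Pi\<^sub>M I (\<lambda>_. density M (\<lambda>z. ennreal (f z)))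
    = density (Pi\<^sub>M I (\<lambda>_. M)) (\<lambda>\<omega>. ennreal (\<Prod>i\<in>I. f (\<omega> i)))"
proof -
  interpret D: prob_space "density M (\<lambda>z. ennreal (f z))" by fact
  interpret DP: product_sigma_finite "\<lambda>_. density M (\<lambda>z. ennreal (f z))" by standard
  interpret P: product_sigma_finite "\<lambda>_. M" by standard
  let ?P = "Pi\<^sub>M I (\<lambda>_. M)"
  have ennreal_prod: "ennreal (\<Prod>i\<in>I. f (\<omega> i)) = (\<Prod>i\<in>I. ennreal (f (\<omega> i)))" if "\<omega> \<in> space ?P" for \<omega>
    using that nn by (subst prod_ennreal) (auto simp: space_PiM PiE_iff)
  have "density ?P (\<lambda>\<omega>. ennreal (\<Prod>i\<in>I. f (\<omega> i))) = Pi\<^sub>M I (\<lambda>_. density M (\<lambda>z. ennreal (f z)))"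
  proof (rule DP.PiM_eqI)
    show "sets (density ?P (\<lambda>\<omega>. ennreal (\<Prod>i\<in>I. f (\<omega> i)))) = sets (Pi\<^sub>M I (\<lambda>_. density M (\<lambda>z. ennreal (f z))))"
      by (simp cong: sets_PiM_cong)
    fix A assume "\<And>i. i \<in> I \<Longrightarrow> A i \<in> sets (density M (\<lambda>z. ennreal (f z)))"
    then have A [measurable]: "\<And>i. i \<in> I \<Longrightarrow> A i \<in> sets M" by simp
    have A': "Pi\<^sub>E I A \<in> sets ?P" by (intro sets_PiM_I_finite A) fact+
    have "emeasure (density ?P (\<lambda>\<omega>. ennreal (\<Prod>i\<in>I. f (\<omega> i)))) (Pi\<^sub>E I A)
        = (\<integral>\<^sup>+\<omega>. ennreal (\<Prod>i\<in>I. f (\<omega> i)) * indicator (Pi\<^sub>E I A) \<omega> \<partial>?P)"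
      using A' by (subst emeasure_density) auto
    also have "\<dots> = (\<integral>\<^sup>+\<omega>. (\<Prod>i\<in>I. ennreal (f (\<omega> i)) * indicator (A i) (\<omega> i)) \<partial>?P)"
    proof (rule nn_integral_cong)
      fix \<omega> assume \<omega>: "\<omega> \<in> space ?P"
      have "indicator (Pi\<^sub>E I A) \<omega> = (\<Prod>i\<in>I. indicator (A i) (\<omega> i) :: ennreal)"
        using \<omega> \<open>finite I\<close> by (auto simp: space_PiM PiE_iff indicator_def prod_zero_iff Pi_iff)
      then show "ennreal (\<Prod>i\<in>I. f (\<omega> i)) * indicator (Pi\<^sub>E I A) \<omega>
          = (\<Prod>i\<in>I. ennreal (f (\<omega> i)) * indicator (A i) (\<omega> i))"
        using ennreal_prod[OF \<omega>] by (simp add: prod.distrib)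
    qed
    also have "\<dots> = (\<Prod>i\<in>I. \<integral>\<^sup>+z. ennreal (f z) * indicator (A i) z \<partial>M)"
      using \<open>finite I\<close> by (subst P.product_nn_integral_prod) auto
    also have "\<dots> = (\<Prod>i\<in>I. emeasure (density M (\<lambda>z. ennreal (f z))) (A i))"
      by (intro prod.cong) (auto simp: emeasure_density)
    finally show "emeasure (density ?P (\<lambda>\<omega>. ennreal (\<Prod>i\<in>I. f (\<omega> i)))) (Pi\<^sub>E I A)
        = (\<Prod>i\<in>I. emeasure (density M (\<lambda>z. ennreal (f z))) (A i))" .
  qed fact
  then show ?thesis by simp
qed

text \<open>Le Cam's method. The average over \<open>g \<in> G\<close> of the error sums is \<open>1 + E ((1 - \<psi>) * (Lbar - 1))\<close>,
  where \<open>Lbar\<close> is the average likelihood ratio and \<open>E\<close> the expectation under the null hypothesis. As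
  \<open>\<bar>1 - \<psi>\<bar> \<le> 1\<close>, it is at least \<open>1 - E \<bar>Lbar - 1\<bar>\<close>, and the second moment of \<open>Lbar\<close>
  is the average of the \<open>n\<close>-th powers of the inner products of the densities. One \<open>g\<close> reaches the average.\<close>

lemma mixture_testing_bound:
  fixes F :: "'b \<Rightarrow> 'a \<Rightarrow> real"
  assumes G: "finite G" "G \<noteq> {}"
    and meas [measurable]: "\<And>g. g \<in> G \<Longrightarrow> F g \<in> borel_measurable M"
    and bnd: "\<And>g z. g \<in> G \<Longrightarrow> z \<in> space M \<Longrightarrow> 0 \<le> F g z \<and> F g z \<le> B"
    and int1: "\<And>g. g \<in> G \<Longrightarrow> (\<integral>z. F g z \<partial>M) = 1"
    and second_moment: "(\<Sum>g\<in>G. \<Sum>h\<in>G. (\<integral>z. F g z * F h z \<partial>M) ^ n) \<le> (1 + \<tau>\<^sup>2) * (real (card G))\<^sup>2"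
    and \<tau>: "0 < \<tau>"
    and \<psi> [measurable]: "\<psi> \<in> borel_measurable (Pi\<^sub>M {..<n} (\<lambda>_. M))"
    and \<psi>01: "\<And>\<omega>. \<omega> \<in> space (Pi\<^sub>M {..<n} (\<lambda>_. M)) \<Longrightarrow> 0 \<le> \<psi> \<omega> \<and> \<psi> \<omega> \<le> 1"
  shows "\<exists>g\<in>G. 1 - \<tau> \<le> (\<integral>\<omega>. \<psi> \<omega> \<partial>Pi\<^sub>M {..<n} (\<lambda>_. M))
    + (\<integral>\<omega>. 1 - \<psi> \<omega> \<partial>Pi\<^sub>M {..<n} (\<lambda>_. density M (\<lambda>z. ennreal (F g z))))"
proof -
  interpret P: product_prob_space "\<lambda>_. M" by (intro product_prob_spaceI) (rule prob_space_axioms)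
  let ?P = "Pi\<^sub>M {..<n} (\<lambda>_. M)"
  interpret PP: prob_space ?P by (rule prob_space_PiM) (rule prob_space_axioms)
  define L where "L = (\<lambda>g \<omega>. \<Prod>i<n. F g (\<omega> i))"
  define X where "X = (\<lambda>\<omega>. (\<Sum>g\<in>G. L g \<omega>) / card G - 1)"
  define C where "C = max B 1 ^ n"
  have cG: "real (card G) > 0" using G by (simp add: card_gt_0_iff)
  have L_meas [measurable]: "L g \<in> borel_measurable ?P" if "g \<in> G" for g
    unfolding L_def using that by measurable
  have L_bnd: "0 \<le> L g \<omega> \<and> L g \<omega> \<le> C" if "g \<in> G" "\<omega> \<in> space ?P" for g \<omega>
  proof -
    have sp: "\<omega> i \<in> space M" if "i < n" for i
      using \<open>\<omega> \<in> space ?P\<close> that by (auto simp: space_PiM)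
    have "L g \<omega> \<le> (\<Prod>i<n. max B 1)"
      unfolding L_def using bnd[OF \<open>g \<in> G\<close> sp] by (intro prod_mono) (auto simp: le_max_iff_disj)
    moreover have "0 \<le> L g \<omega>" unfolding L_def using bnd[OF \<open>g \<in> G\<close> sp] by (intro prod_nonneg) auto
    ultimately show ?thesis by (simp add: C_def)
  qed
  have B0: "0 \<le> B" using G bnd not_empty by (meson all_not_in_conv order.trans)
  have C1: "C \<ge> 1" by (simp add: C_def)
  have bounded_integrable: "integrable ?P h"
    if "h \<in> borel_measurable ?P" "\<And>\<omega>. \<omega> \<in> space ?P \<Longrightarrow> \<bar>h \<omega>\<bar> \<le> c" for h :: "_ \<Rightarrow> real" and c
    using that by (intro PP.integrable_const_bound[where B = c]) auto
  have L_int [simp]: "integrable ?P (L g)" if "g \<in> G" for g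
    using L_bnd that by (intro bounded_integrable[of _ C]) auto
  have LL_int [simp]: "integrable ?P (\<lambda>\<omega>. L g \<omega> * L h \<omega>)" if "g \<in> G" "h \<in> G" for g h
    using L_bnd that C1 by (intro bounded_integrable[of _ "C * C"]) (auto simp: abs_mult intro!: mult_mono)
  have F_int: "integrable M (F g)" if "g \<in> G" for g
    using bnd that by (intro integrable_const_bound[where B = B]) auto
  have FF_int: "integrable M (\<lambda>z. F g z * F h z)" if "g \<in> G" "h \<in> G" for g h
    using bnd that B0 by (intro integrable_const_bound[where B = "B * B"])
      (auto simp: abs_mult intro!: mult_mono)
  have int_L: "(\<integral>\<omega>. L g \<omega> \<partial>?P) = 1" if "g \<in> G" for g
    unfolding L_def using that by (subst P.product_integral_prod) (auto simp: F_int int1)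
  have int_LL: "(\<integral>\<omega>. L g \<omega> * L h \<omega> \<partial>?P) = (\<integral>z. F g z * F h z \<partial>M) ^ n" if "g \<in> G" "h \<in> G" for g h
    unfolding L_def prod.distrib[symmetric] using that
    by (subst P.product_integral_prod) (auto simp: FF_int)
  have expect_L: "(\<integral>\<omega>. 1 - \<psi> \<omega> \<partial>Pi\<^sub>M {..<n} (\<lambda>_. density M (\<lambda>z. ennreal (F g z))))
      = (\<integral>\<omega>. L g \<omega> * (1 - \<psi> \<omega>) \<partial>?P)" if "g \<in> G" for g
  proof -
    have "emeasure (density M (\<lambda>z. ennreal (F g z))) (space M) = ennreal (\<integral>z. F g z \<partial>M)"
      using bnd[OF that] that F_int[OF that]
      by (subst emeasure_density) (auto simp: nn_integral_eq_integral cong: nn_integral_cong_simp)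
    then have "prob_space (density M (\<lambda>z. ennreal (F g z)))"
      using that by (intro prob_spaceI) (simp add: int1)
    then have "Pi\<^sub>M {..<n} (\<lambda>_. density M (\<lambda>z. ennreal (F g z))) = density ?P (\<lambda>\<omega>. ennreal (L g \<omega>))"
      unfolding L_def using bnd[OF that] that by (intro PiM_density) auto
    then show ?thesis
      using that L_bnd by (simp add: integral_density)
  qed
  have X_meas [measurable]: "X \<in> borel_measurable ?P" unfolding X_def by measurable
  have sumLL: "(\<Sum>g\<in>G. L g \<omega>)\<^sup>2 = (\<Sum>g\<in>G. \<Sum>h\<in>G. L g \<omega> * L h \<omega>)" for \<omega>
    by (simp add: power2_eq_square sum_product)
  have X2: "(X \<omega>)\<^sup>2 = (\<Sum>g\<in>G. \<Sum>h\<in>G. L g \<omega> * L h \<omega>) / (card G)\<^sup>2 - 2 * ((\<Sum>g\<in>G. L g \<omega>) / card G) + 1" for \<omega>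
    unfolding X_def sumLL[symmetric] by (simp add: power2_diff power_divide)
  have X2_int: "integrable ?P (\<lambda>\<omega>. (X \<omega>)\<^sup>2)"
    unfolding X2 by (intro Bochner_Integration.integrable_add Bochner_Integration.integrable_diff
      integrable_divide integrable_mult_right Bochner_Integration.integrable_sum LL_int L_int) auto
  have "(\<integral>\<omega>. (X \<omega>)\<^sup>2 \<partial>?P)
      = (\<Sum>g\<in>G. \<Sum>h\<in>G. (\<integral>z. F g z * F h z \<partial>M) ^ n) / (card G)\<^sup>2 - 2 * (card G / card G) + 1"
    unfolding X2 by (simp add: int_L int_LL PP.prob_space)
  also have "\<dots> \<le> (1 + \<tau>\<^sup>2) - 2 + 1"
  proof -
    have "(\<Sum>g\<in>G. \<Sum>h\<in>G. (\<integral>z. F g z * F h z \<partial>M) ^ n) / (card G)\<^sup>2 \<le> 1 + \<tau>\<^sup>2"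
      using second_moment cG by (subst pos_divide_le_eq) auto
    then show ?thesis using cG by simp
  qed
  finally have EX2: "(\<integral>\<omega>. (X \<omega>)\<^sup>2 \<partial>?P) \<le> \<tau>\<^sup>2" by simp
  have \<psi>_int: "integrable ?P \<psi>" using \<psi>01 by (intro bounded_integrable[of _ 1]) auto
  have L\<psi>_int: "integrable ?P (\<lambda>\<omega>. L g \<omega> * (1 - \<psi> \<omega>))" if "g \<in> G" for g
  proof (rule bounded_integrable[of _ "C * 1"])
    fix \<omega> assume "\<omega> \<in> space ?P"
    then show "\<bar>L g \<omega> * (1 - \<psi> \<omega>)\<bar> \<le> C * 1"
      unfolding abs_mult using L_bnd[OF that] \<psi>01 C1 by (intro mult_mono) auto
  qed (use that in measurable)
  have X\<psi>: "X \<omega> * (1 - \<psi> \<omega>) = (\<Sum>g\<in>G. L g \<omega> * (1 - \<psi> \<omega>)) / card G - (1 - \<psi> \<omega>)" for \<omega>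
    by (simp only: X_def left_diff_distrib mult_1 sum_distrib_right[symmetric] times_divide_eq_left)
  have X\<psi>_int: "integrable ?P (\<lambda>\<omega>. X \<omega> * (1 - \<psi> \<omega>))"
    unfolding X\<psi> using L\<psi>_int \<psi>_int by (intro Bochner_Integration.integrable_diff integrable_divide
      Bochner_Integration.integrable_sum) auto
  \<comment> \<open>Instead of the Cauchy-Schwarz inequality: \<open>2 * \<tau> * \<bar>X\<bar> \<le> \<tau>\<^sup>2 + X\<^sup>2\<close>, integrated.\<close>
  have "- \<tau> \<le> - ((\<tau>\<^sup>2 + (\<integral>\<omega>. (X \<omega>)\<^sup>2 \<partial>?P)) / (2 * \<tau>))"
    using EX2 \<tau> by (simp add: power2_eq_square divide_simps)
  also have "\<dots> = (\<integral>\<omega>. - ((\<tau>\<^sup>2 + (X \<omega>)\<^sup>2) / (2 * \<tau>)) \<partial>?P)"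
    using X2_int by (simp add: PP.prob_space)
  also have "\<dots> \<le> (\<integral>\<omega>. X \<omega> * (1 - \<psi> \<omega>) \<partial>?P)"
  proof (rule integral_mono)
    show "integrable ?P (\<lambda>\<omega>. - ((\<tau>\<^sup>2 + (X \<omega>)\<^sup>2) / (2 * \<tau>)))" using X2_int by simp
    fix \<omega> assume "\<omega> \<in> space ?P"
    then have "\<bar>X \<omega> * (1 - \<psi> \<omega>)\<bar> \<le> \<bar>X \<omega>\<bar> * 1"
      unfolding abs_mult using \<psi>01 by (intro mult_left_mono) auto
    moreover have "\<bar>X \<omega>\<bar> \<le> (\<tau>\<^sup>2 + (X \<omega>)\<^sup>2) / (2 * \<tau>)"
      using \<tau> sum_squares_bound[of \<tau> "\<bar>X \<omega>\<bar>"] by (simp add: pos_le_divide_eq mult_ac)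
    ultimately show "- ((\<tau>\<^sup>2 + (X \<omega>)\<^sup>2) / (2 * \<tau>)) \<le> X \<omega> * (1 - \<psi> \<omega>)" by linarith
  qed (rule X\<psi>_int)
  also have "\<dots> = (\<Sum>g\<in>G. \<integral>\<omega>. L g \<omega> * (1 - \<psi> \<omega>) \<partial>?P) / card G - (1 - (\<integral>\<omega>. \<psi> \<omega> \<partial>?P))"
    unfolding X\<psi> using L\<psi>_int \<psi>_int by (simp add: PP.prob_space)
  finally have avg: "(1 - \<tau>) * card G
      \<le> (\<Sum>g\<in>G. (\<integral>\<omega>. \<psi> \<omega> \<partial>?P) + (\<integral>\<omega>. L g \<omega> * (1 - \<psi> \<omega>) \<partial>?P))"
    using cG by (simp add: sum.distrib field_simps)
  show ?thesis
  proof (rule ccontr)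
    assume "\<not> ?thesis"
    then have "(\<Sum>g\<in>G. (\<integral>\<omega>. \<psi> \<omega> \<partial>?P) + (\<integral>\<omega>. L g \<omega> * (1 - \<psi> \<omega>) \<partial>?P)) < (\<Sum>g\<in>G. 1 - \<tau>)"
      using G by (intro sum_strict_mono) (auto simp: expect_L not_le)
    then show False using avg by (simp add: mult.commute)
  qed
qed

end

section \<open>Orthonormality of the Fourier basis\<close>

lemma unit_cube_eq_cbox: "(unit_cube :: (real ^ 'd::finite) set) = cbox 0 1"
  by (auto simp: unit_cube_def cbox_interval less_eq_vec_def)

lemma closed_unit_cube: "closed (unit_cube :: (real ^ 'd::finite) set)"
  by (metis unit_cube_eq_cbox closed_cbox)

lemma space_cube_measure [simp]: "space (cube_measure :: (real ^ 'd::finite) measure) = unit_cube"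
  by (simp add: cube_measure_def space_restrict_space)

lemma prob_space_cube_measure: "prob_space (cube_measure :: (real ^ 'd::finite) measure)"
proof
  have "emeasure (cube_measure :: (real ^ 'd) measure) unit_cube = emeasure lborel (cbox (0::real^'d) 1)"
    unfolding cube_measure_def using closed_unit_cube
    by (subst emeasure_restrict_space) (auto simp: unit_cube_eq_cbox)
  also have "\<dots> = ennreal (\<Prod>b\<in>Basis. (1 - 0 :: real ^ 'd) \<bullet> b)"
    by (rule emeasure_lborel_cbox) (auto simp: Basis_vec_def inner_axis)
  also have "(\<Prod>b\<in>Basis. (1 - 0 :: real ^ 'd) \<bullet> b) = 1"
    by (rule prod.neutral) (auto simp: Basis_vec_def inner_axis)
  also have "ennreal 1 = 1" by simp
  finally show "emeasure (cube_measure :: (real ^ 'd) measure) (space cube_measure) = 1" by simp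
qed

lemma measurable_cube_measure_continuous:
  fixes f :: "real ^ 'd::finite \<Rightarrow> 'b::topological_space"
  assumes "continuous_on UNIV f"
  shows "f \<in> borel_measurable cube_measure"
  unfolding cube_measure_def using borel_measurable_continuous_onI[OF assms]
  by (intro measurable_restrict_space1) auto


text \<open>Fubini's theorem for all coordinates at once: Lebesgue measure on \<open>real ^ 'd\<close> is the image of a
  product of one-dimensional Lebesgue measures, and the indicator of the cube is itself a product.\<close>

lemma integral_cube_prod:
  fixes \<phi> :: "'d::finite \<Rightarrow> real \<Rightarrow> complex"
  assumes "\<And>l. continuous_on UNIV (\<phi> l)"
  shows "(\<integral>x. (\<Prod>l\<in>UNIV. \<phi> l (x $ l)) \<partial>(cube_measure :: (real ^ 'd) measure))
    = (\<Prod>l\<in>UNIV. \<integral>t. indicator {0..1} t *\<^sub>R \<phi> l t \<partial>lborel)"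
proof -
  have [measurable]: "\<phi> l \<in> borel_measurable borel" for l
    using assms by (rule borel_measurable_continuous_onI)
  define \<psi> where "\<psi> = (\<lambda>l t. indicator {0..1::real} t *\<^sub>R \<phi> l t)"
  have \<psi>m [measurable]: "\<psi> l \<in> borel_measurable borel" for l
    unfolding \<psi>_def by measurable
  have \<psi>_int: "integrable lborel (\<psi> l)" for l
    unfolding \<psi>_def using continuous_on_subset[OF assms[of l] subset_UNIV]
    by (intro borel_integrable_compact) auto
  have ind: "indicator unit_cube x *\<^sub>R (\<Prod>l\<in>UNIV. \<phi> l (x $ l)) = (\<Prod>l\<in>UNIV. \<psi> l (x $ l))"
    for x :: "real ^ 'd"
  proof (cases "x \<in> unit_cube")
    case False
    then obtain l where "x $ l \<notin> {0..1}" by (auto simp: unit_cube_def)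
    then have "\<psi> l (x $ l) = 0" by (simp add: \<psi>_def)
    then have "(\<Prod>l\<in>UNIV. \<psi> l (x $ l)) = 0" by (intro prod_zero) auto
    then show ?thesis using False by simp
  qed (simp add: \<psi>_def unit_cube_def)
  have bas: "(Basis :: (real ^ 'd) set) = (\<lambda>l. axis l 1) ` UNIV"
    by (auto simp: Basis_vec_def)
  have inj: "inj (\<lambda>l::'d. axis l (1::real))" by (auto simp: inj_on_def axis_eq_axis)
  have reix: "(\<Prod>l\<in>UNIV. h l) = (\<Prod>b\<in>(Basis :: (real ^ 'd) set). h (axis_index b))" for h :: "'d \<Rightarrow> complex"
    unfolding bas prod.reindex[OF inj, of "h \<circ> axis_index"] by (simp add: o_def axis_index_axis prod.reindex[OF inj])
  have comp: "(\<Sum>b\<in>Basis. f b * b $ l) = f (axis l 1)" for f :: "real ^ 'd \<Rightarrow> real" and l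
    unfolding bas using inj by (subst sum.reindex) (auto simp: axis_def if_distrib cong: if_cong)
  have ax: "axis (axis_index b) 1 = b" if "b \<in> Basis" for b :: "real ^ 'd"
    using that by (auto simp: bas axis_index_axis)
  interpret product_sigma_finite "\<lambda>b::real ^ 'd. lborel :: real measure"
    by standard
  have "(\<integral>x. (\<Prod>l\<in>UNIV. \<phi> l (x $ l)) \<partial>(cube_measure :: (real ^ 'd) measure))
      = (\<integral>x. indicator unit_cube x *\<^sub>R (\<Prod>l\<in>UNIV. \<phi> l (x $ l)) \<partial>(lborel :: (real ^ 'd) measure))"
    unfolding cube_measure_def using borel_closed[OF closed_unit_cube] by (subst integral_restrict_space) auto
  also have "\<dots> = (\<integral>x. (\<Prod>l\<in>UNIV. \<psi> l (x $ l)) \<partial>(lborel :: (real ^ 'd) measure))"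
    by (simp only: ind)
  also have "\<dots> = (\<integral>f. (\<Prod>l\<in>UNIV. \<psi> l (f (axis l 1))) \<partial>(\<Pi>\<^sub>M b\<in>(Basis :: (real ^ 'd) set). lborel))"
    by (subst lborel_eq, subst integral_distr) (auto simp: comp)
  also have "\<dots> = (\<integral>f. (\<Prod>b\<in>Basis. \<psi> (axis_index b) (f b)) \<partial>(\<Pi>\<^sub>M b\<in>(Basis :: (real ^ 'd) set). lborel))"
    by (intro arg_cong[where f="integral\<^sup>L _"] ext) (auto simp: reix ax intro!: prod.cong)
  also have "\<dots> = (\<Prod>b\<in>(Basis :: (real ^ 'd) set). integral\<^sup>L lborel (\<psi> (axis_index b)))"
    by (rule product_integral_prod) (auto intro: \<psi>_int)
  also have "\<dots> = (\<Prod>l\<in>UNIV. integral\<^sup>L lborel (\<psi> l))" by (simp add: reix)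
  finally show ?thesis by (simp add: \<psi>_def)
qed

lemma integral_unit_interval_exp:
  fixes k :: int
  shows "(\<integral>t. indicator {0..1} t *\<^sub>R exp (2 * of_real pi * \<i> * of_int k * of_real t) \<partial>lborel)
    = (if k = 0 then 1 else (0::complex))"
proof (cases "k = 0")
  case False
  define w :: complex where "w = 2 * of_real pi * \<i> * of_int k"
  have w0: "w \<noteq> 0" using False by (simp add: w_def)
  have "has_bochner_integral lborel (\<lambda>t. indicator {0..1} t *\<^sub>R exp (w * of_real t))
      (exp (w * of_real 1) / w - exp (w * of_real 0) / w)"
  proof (rule has_bochner_integral_FTC_Icc)
    fix t :: real
    show "((\<lambda>t. exp (w * of_real t) / w) has_vector_derivative exp (w * of_real t)) (at t within {0..1})"
      using w0 by (auto intro!: derivative_eq_intros has_vector_derivative_real_field)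
  qed (auto intro!: continuous_intros)
  moreover have "exp w = 1"
    unfolding exp_eq_1 by (auto simp: w_def)
  ultimately show ?thesis using False
    by (simp add: has_bochner_integral_iff w_def)
qed simp

text \<open>The phase \<open>c\<close> covers cosines and sines together, and the integer frequencies may be negative
  because the product of two basis functions involves the difference of their frequencies.\<close>

lemma integral_cube_cos:
  fixes k :: "'d::finite \<Rightarrow> int"
  shows "(\<integral>x. cos (2 * pi * (\<Sum>l\<in>UNIV. of_int (k l) * x $ l) + c) \<partial>(cube_measure :: (real ^ 'd) measure))
    = (if \<forall>l. k l = 0 then cos c else 0)"
proof -
  let ?e = "\<lambda>x::real^'d. \<Prod>l\<in>UNIV. exp (2 * of_real pi * \<i> * of_int (k l) * complex_of_real (x $ l))"
  have exp_cos: "cos (2 * pi * (\<Sum>l\<in>UNIV. of_int (k l) * x $ l) + c) = Re (exp (\<i> * of_real c) * ?e x)"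
    for x :: "real ^ 'd"
  proof -
    have "exp (\<i> * of_real c) * ?e x
        = exp (\<i> * of_real (2 * pi * (\<Sum>l\<in>UNIV. of_int (k l) * x $ l) + c))"
      by (subst exp_sum[symmetric], simp, subst exp_add[symmetric])
        (simp add: sum_distrib_left algebra_simps)
    then show ?thesis by (metis Re_exp cis_conv_exp cis.simps(1))
  qed
  have int: "(\<integral>x. ?e x \<partial>(cube_measure :: (real ^ 'd) measure)) = (if \<forall>l. k l = 0 then 1 else 0)"
  proof -
    have "(\<integral>x. ?e x \<partial>(cube_measure :: (real ^ 'd) measure)) = (\<Prod>l\<in>UNIV. if k l = 0 then 1 else 0)"
      by (subst integral_cube_prod) (auto intro!: continuous_intros simp: integral_unit_interval_exp)
    also have "\<dots> = (if \<forall>l. k l = 0 then 1 else 0)" by (auto intro: prod_zero)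
    finally show ?thesis .
  qed
  interpret prob_space "cube_measure :: (real ^ 'd) measure" by (rule prob_space_cube_measure)
  have "integrable (cube_measure :: (real ^ 'd) measure) ?e"
    by (rule integrable_const_bound[where B = 1])
      (auto simp: prod_norm[symmetric] norm_exp_eq_Re intro!: measurable_cube_measure_continuous continuous_intros)
  then have "(\<integral>x. Re (exp (\<i> * of_real c) * ?e x) \<partial>(cube_measure :: (real ^ 'd) measure))
      = Re (exp (\<i> * of_real c) * (\<integral>x. ?e x \<partial>(cube_measure :: (real ^ 'd) measure)))"
    by (subst integral_Re) auto
  then show ?thesis by (simp add: exp_cos int Re_exp)
qed

text \<open>The index \<open>a\<close> only shifts the phase by a quarter period.\<close>

lemma fourier_basis_eq_cos:
  "fourier_basis (a, m) x =
     (if m = 0 then 1 else sqrt 2 * cos (2 * pi * (\<Sum>l\<in>UNIV. real (m $ l) * x $ l) + real a * pi / 2))"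
proof -
  let ?t = "2 * pi * (\<Sum>l\<in>UNIV. real (m $ l) * x $ l) + real a * pi / 2"
  have eq: "exp (- (of_nat a * of_real pi * \<i> / 2)) *
               (\<Prod>l\<in>UNIV. exp (- (2 * of_real pi * \<i> * of_nat (m $ l) * of_real (x $ l))))
     = cis (- ?t)"
    by (subst exp_sum[symmetric], simp, subst exp_add[symmetric])
      (simp add: cis_conv_exp sum_distrib_left sum_negf algebra_simps)
  show ?thesis unfolding fourier_basis_def prod.case eq by (simp only: cis.sel cos_minus)
qed

lemma abs_fourier_basis_le: "\<bar>fourier_basis j x\<bar> \<le> sqrt 2"
proof (cases j)
  case (Pair a m)
  have "sqrt 2 * \<bar>cos t\<bar> \<le> sqrt 2 * 1" for t :: real
    by (intro mult_left_mono) auto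
  then show ?thesis by (simp add: Pair fourier_basis_eq_cos abs_mult)
qed

lemma continuous_fourier_basis: "continuous_on S (fourier_basis j)"
proof (cases j)
  case (Pair a m)
  show ?thesis unfolding Pair fourier_basis_eq_cos by (cases "m = 0") (auto intro!: continuous_intros)
qed

lemma measurable_fourier_basis [measurable]: "fourier_basis j \<in> borel_measurable cube_measure"
  by (intro measurable_cube_measure_continuous continuous_fourier_basis)

lemma fourier_basis_0 [simp]: "fourier_basis (0, 0) x = 1"
  by (simp add: fourier_basis_def)

text \<open>The product of two basis functions is the sum of a cosine at the difference and a cosine at the sum
  of the frequencies. Frequencies are nonnegative, so the sum vanishes only if both do; the
  difference leaves \<open>cos ((a - b) * pi / 2)\<close> when the frequencies agree, which is 0 for \<open>a \<noteq> b\<close>.\<close>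

lemma fourier_basis_orthonormal:
  fixes j k :: "'d::finite index"
  assumes "j \<in> index_set" "k \<in> index_set"
  shows "(\<integral>x. fourier_basis j x * fourier_basis k x \<partial>cube_measure) = (if j = k then 1 else 0)"
proof -
  interpret prob_space "cube_measure :: (real ^ 'd) measure" by (rule prob_space_cube_measure)
  obtain a m b m' where j: "j = (a, m)" and k: "k = (b, m')" by (cases j, cases k)
  have ab: "a = 0 \<or> a = 1" "b = 0 \<or> b = 1" "m = 0 \<longrightarrow> a = 0" "m' = 0 \<longrightarrow> b = 0"
    using assms by (auto simp: j k index_set_def)
  have cos0: "(\<integral>x. cos (2 * pi * (\<Sum>l\<in>UNIV. real (m $ l) * x $ l) + c) \<partial>(cube_measure :: (real ^ 'd) measure)) = 0"
    if "m \<noteq> 0" for m :: "nat ^ 'd" and c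
    using integral_cube_cos[of "\<lambda>l. int (m $ l)" c] that by (auto simp: vec_eq_iff)
  have fb0: "(\<integral>x. fourier_basis (a, m) x \<partial>(cube_measure :: (real ^ 'd) measure)) = 0"
    if "m \<noteq> 0" for a and m :: "nat ^ 'd"
    using that by (simp add: fourier_basis_eq_cos cos0)
  show ?thesis
  proof (cases "m = 0 \<or> m' = 0")
    case True
    then show ?thesis using ab cos0 by (auto simp: j k fb0 prob_space[simplified])
  next
    case False
    let ?\<alpha> = "\<lambda>x::real^'d. 2 * pi * (\<Sum>l\<in>UNIV. real (m $ l) * x $ l) + real a * pi / 2"
    let ?\<beta> = "\<lambda>x::real^'d. 2 * pi * (\<Sum>l\<in>UNIV. real (m' $ l) * x $ l) + real b * pi / 2"
    let ?c = "(real a - real b) * pi / 2"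
    have int: "integrable (cube_measure :: (real ^ 'd) measure) (\<lambda>x. cos (h x))"
      if "continuous_on UNIV h" for h :: "real ^ 'd \<Rightarrow> real"
    proof (rule integrable_const_bound[where B = 1])
      show "(\<lambda>x. cos (h x)) \<in> borel_measurable cube_measure"
        using that by (intro measurable_cube_measure_continuous continuous_on_cos)
    qed simp
    have diff: "?\<alpha> x - ?\<beta> x = 2 * pi * (\<Sum>l\<in>UNIV. of_int (int (m $ l) - int (m' $ l)) * x $ l) + ?c" for x
      by (simp add: sum_subtractf algebra_simps diff_divide_distrib)
    have add: "?\<alpha> x + ?\<beta> x = 2 * pi * (\<Sum>l\<in>UNIV. of_int (int (m $ l) + int (m' $ l)) * x $ l)
        + (real a + real b) * pi / 2" for x
      by (simp add: sum.distrib algebra_simps add_divide_distrib)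
    have prod: "fourier_basis j x * fourier_basis k x = cos (?\<alpha> x - ?\<beta> x) + cos (?\<alpha> x + ?\<beta> x)" for x
    proof -
      have "sqrt 2 * cos u * (sqrt 2 * cos v) = cos (u - v) + cos (u + v)" for u v :: real
        by (simp add: cos_add cos_diff)
      then show ?thesis using False unfolding j k fourier_basis_eq_cos by simp
    qed
    have "(\<integral>x. fourier_basis j x * fourier_basis k x \<partial>cube_measure)
        = (\<integral>x. cos (?\<alpha> x - ?\<beta> x) \<partial>cube_measure) + (\<integral>x. cos (?\<alpha> x + ?\<beta> x) \<partial>cube_measure)"
      unfolding prod by (intro Bochner_Integration.integral_add int continuous_intros)
    also have "(\<integral>x. cos (?\<alpha> x + ?\<beta> x) \<partial>cube_measure) = 0"
    proof -
      obtain l where "m $ l \<noteq> 0" using False by (auto simp: vec_eq_iff)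
      then have "int (m $ l) + int (m' $ l) \<noteq> 0" by simp
      then show ?thesis unfolding add integral_cube_cos by auto
    qed
    also have "(\<integral>x. cos (?\<alpha> x - ?\<beta> x) \<partial>cube_measure) = (if m = m' then cos ?c else 0)"
      unfolding diff integral_cube_cos by (auto simp: vec_eq_iff)
    also have "\<dots> + 0 = (if j = k then 1 else 0)"
      using ab by (auto simp: j k)
    finally show ?thesis .
  qed
qed

section \<open>Perturbations of the uniform density\<close>

lemma space_mu [simp]: "space (mu :: ((real ^ 'dx::finite) \<times> (real ^ 'dy::finite)) measure) = unit_cube \<times> unit_cube"
  by (simp add: mu_def space_pair_measure)

lemma prob_space_mu: "prob_space (mu :: ((real ^ 'dx::finite) \<times> (real ^ 'dy::finite)) measure)"
  unfolding mu_def by (intro prob_space_pair prob_space_cube_measure)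

lemma measurable_tensor_basis [measurable]:
  "tensor_basis j k \<in> borel_measurable (mu :: ((real ^ 'dx::finite) \<times> (real ^ 'dy::finite)) measure)"
  unfolding tensor_basis_def[abs_def] mu_def by measurable

lemma integral_mu_times:
  fixes g :: "real ^ 'dx::finite \<Rightarrow> real" and h :: "real ^ 'dy::finite \<Rightarrow> real"
  assumes g: "integrable cube_measure g" and h: "integrable cube_measure h"
  shows "integrable mu (\<lambda>z. g (fst z) * h (snd z))"
    and "(\<integral>z. g (fst z) * h (snd z) \<partial>mu) = (\<integral>x. g x \<partial>cube_measure) * (\<integral>y. h y \<partial>cube_measure)"
proof -
  interpret X: prob_space "cube_measure :: (real ^ 'dx) measure" by (rule prob_space_cube_measure)
  interpret Y: prob_space "cube_measure :: (real ^ 'dy) measure" by (rule prob_space_cube_measure)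
  interpret P: pair_prob_space "cube_measure :: (real ^ 'dx) measure" "cube_measure :: (real ^ 'dy) measure" ..
  have [measurable]: "g \<in> borel_measurable cube_measure" "h \<in> borel_measurable cube_measure"
    using g h by auto
  show int: "integrable mu (\<lambda>z. g (fst z) * h (snd z))"
    unfolding mu_def using g h
    by (intro P.Fubini_integrable) (auto simp: abs_mult)
  then show "(\<integral>z. g (fst z) * h (snd z) \<partial>mu) = (\<integral>x. g x \<partial>cube_measure) * (\<integral>y. h y \<partial>cube_measure)"
    using P.integral_fst'[of "\<lambda>z. g (fst z) * h (snd z)"] by (simp add: mu_def)
qed

lemma integrable_fourier_basis [simp]: "integrable cube_measure (fourier_basis (j :: 'd::finite index))"
proof -
  interpret prob_space "cube_measure :: (real ^ 'd) measure" by (rule prob_space_cube_measure)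
  show ?thesis by (rule integrable_const_bound[where B = "sqrt 2"]) (auto simp: abs_fourier_basis_le)
qed

lemma abs_fourier_basis_mult_le: "\<bar>fourier_basis j x * fourier_basis k y\<bar> \<le> 2"
  using mult_mono[OF abs_fourier_basis_le[of j x] abs_fourier_basis_le[of k y]] by (simp add: abs_mult)

lemma integrable_fourier_basis_mult [simp]:
  "integrable cube_measure (\<lambda>x. fourier_basis (j :: 'd::finite index) x * fourier_basis k x)"
proof -
  interpret prob_space "cube_measure :: (real ^ 'd) measure" by (rule prob_space_cube_measure)
  show ?thesis by (rule integrable_const_bound[where B = "2"]) (auto simp: abs_fourier_basis_mult_le simp del: abs_mult)
qed

lemma abs_tensor_basis_le: "\<bar>tensor_basis j k z\<bar> \<le> 2"
  unfolding tensor_basis_def by (rule abs_fourier_basis_mult_le)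

lemma tensor_basis_square_le: "(tensor_basis j k z)\<^sup>2 \<le> 4"
  using power_mono[OF abs_tensor_basis_le[of j k z], of 2] by simp

lemma integrable_tensor_basis [simp]: "integrable mu (tensor_basis j k)"
  unfolding tensor_basis_def[abs_def] by (intro integral_mu_times) auto

lemma integrable_tensor_basis_mult [simp]:
  "integrable mu (\<lambda>z. tensor_basis j k z * tensor_basis j' k' z)"
proof -
  have "tensor_basis j k z * tensor_basis j' k' z
      = (fourier_basis j (fst z) * fourier_basis j' (fst z)) * (fourier_basis k (snd z) * fourier_basis k' (snd z))" for z
    by (simp add: tensor_basis_def)
  then show ?thesis
    using integral_mu_times(1)[OF integrable_fourier_basis_mult[of j j'] integrable_fourier_basis_mult[of k k']] by simp
qed

lemma zero_mem_index_set [simp]: "(0, 0) \<in> index_set"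
  by (simp add: index_set_def)

lemma integral_fourier_basis:
  "j \<in> index_set \<Longrightarrow> (\<integral>x. fourier_basis j x \<partial>cube_measure) = (if j = (0, 0) then 1 else 0)"
  using fourier_basis_orthonormal[of j "(0, 0)"] by simp

lemma tensor_basis_orthonormal:
  assumes "j \<in> index_set" "k \<in> index_set" "j' \<in> index_set" "k' \<in> index_set"
  shows "(\<integral>z. tensor_basis j k z * tensor_basis j' k' z \<partial>mu) = (if j = j' \<and> k = k' then 1 else 0)"
proof -
  have "tensor_basis j k z * tensor_basis j' k' z
      = (fourier_basis j (fst z) * fourier_basis j' (fst z)) * (fourier_basis k (snd z) * fourier_basis k' (snd z))" for z
    by (simp add: tensor_basis_def)
  then show ?thesis using assms
    by (simp add: fourier_basis_orthonormal
        integral_mu_times(2)[OF integrable_fourier_basis_mult[of j j'] integrable_fourier_basis_mult[of k k']])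
qed

definition perturbation ::
  "('dx::finite index \<times> 'dy::finite index) set \<Rightarrow> ('dx index \<times> 'dy index \<Rightarrow> real) \<Rightarrow> (real ^ 'dx) \<times> (real ^ 'dy) \<Rightarrow> real"
  where "perturbation I c z = (\<Sum>i\<in>I. c i * tensor_basis (fst i) (snd i) z)"

lemma measurable_perturbation [measurable]: "perturbation I c \<in> borel_measurable mu"
  unfolding perturbation_def[abs_def] by measurable

text \<open>Leaving out the index \<open>(0, 0)\<close> on both sides makes every \<open>tensor_basis\<close> term average to zero in
  each variable separately, which is what keeps the marginals uniform.\<close>

locale nonconstant_frequencies =
  fixes I :: "('dx::finite index \<times> 'dy::finite index) set"
  assumes finite_I: "finite I"
    and I_subset: "I \<subseteq> (index_set - {(0, 0)}) \<times> (index_set - {(0, 0)})"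
begin

lemma I_cases: "i \<in> I \<Longrightarrow> fst i \<in> index_set \<and> snd i \<in> index_set \<and> fst i \<noteq> (0, 0) \<and> snd i \<noteq> (0, 0)"
  using I_subset by auto

lemma integrable_perturbation [simp]: "integrable mu (perturbation I c)"
  unfolding perturbation_def[abs_def] by simp

lemma integral_perturbation_tensor_basis:
  assumes "j \<in> index_set" "k \<in> index_set"
  shows "integrable mu (\<lambda>z. perturbation I c z * tensor_basis j k z)"
    and "(\<integral>z. perturbation I c z * tensor_basis j k z \<partial>mu) = (if (j, k) \<in> I then c (j, k) else 0)"
proof -
  have eq: "perturbation I c z * tensor_basis j k z
      = (\<Sum>i\<in>I. c i * (tensor_basis (fst i) (snd i) z * tensor_basis j k z))" for z
    by (simp add: perturbation_def sum_distrib_right mult.assoc)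
  show "integrable mu (\<lambda>z. perturbation I c z * tensor_basis j k z)" unfolding eq by simp
  have "(\<integral>z. perturbation I c z * tensor_basis j k z \<partial>mu)
      = (\<Sum>i\<in>I. c i * (\<integral>z. tensor_basis (fst i) (snd i) z * tensor_basis j k z \<partial>mu))"
    unfolding eq by simp
  also have "\<dots> = (\<Sum>i\<in>I. if i = (j, k) then c i else 0)"
    using I_cases assms by (intro sum.cong) (auto simp: tensor_basis_orthonormal prod_eq_iff)
  also have "\<dots> = (if (j, k) \<in> I then c (j, k) else 0)" using finite_I by (simp add: sum.delta)
  finally show "(\<integral>z. perturbation I c z * tensor_basis j k z \<partial>mu) = (if (j, k) \<in> I then c (j, k) else 0)" .
qed

lemma integral_perturbation: "(\<integral>z. perturbation I c z \<partial>mu) = 0"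
  using integral_perturbation_tensor_basis(2)[of "(0, 0)" "(0, 0)" c] I_cases[of "((0, 0), (0, 0))"]
  by (auto simp: tensor_basis_def)

lemma integral_perturbation_mult:
  shows "integrable mu (\<lambda>z. perturbation I c z * perturbation I c' z)"
    and "(\<integral>z. perturbation I c z * perturbation I c' z \<partial>mu) = (\<Sum>i\<in>I. c i * c' i)"
proof -
  have eq: "perturbation I c z * perturbation I c' z
      = (\<Sum>i\<in>I. c' i * (perturbation I c z * tensor_basis (fst i) (snd i) z))" for z
    by (subst (2) perturbation_def) (simp add: sum_distrib_left mult_ac)
  show "integrable mu (\<lambda>z. perturbation I c z * perturbation I c' z)"
    unfolding eq using I_cases integral_perturbation_tensor_basis(1)
    by (intro Bochner_Integration.integrable_sum integrable_mult_right) auto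
  have "(\<integral>z. perturbation I c z * perturbation I c' z \<partial>mu)
     = (\<Sum>i\<in>I. c' i * (\<integral>z. perturbation I c z * tensor_basis (fst i) (snd i) z \<partial>mu))"
    unfolding eq using I_cases integral_perturbation_tensor_basis(1)
    by (subst Bochner_Integration.integral_sum) auto
  also have "\<dots> = (\<Sum>i\<in>I. c i * c' i)"
    using I_cases by (intro sum.cong) (auto simp: integral_perturbation_tensor_basis)
  finally show "(\<integral>z. perturbation I c z * perturbation I c' z \<partial>mu) = (\<Sum>i\<in>I. c i * c' i)" .
qed

lemma integral_perturbed_mult:
  "(\<integral>z. (1 + perturbation I c z) * (1 + perturbation I c' z) \<partial>mu) = 1 + (\<Sum>i\<in>I. c i * c' i)"
proof -
  interpret prob_space "mu :: ((real ^ 'dx) \<times> (real ^ 'dy)) measure" by (rule prob_space_mu)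
  have "(\<integral>z. (1 + perturbation I c z) * (1 + perturbation I c' z) \<partial>mu)
     = (\<integral>z. 1 + perturbation I c z + perturbation I c' z + perturbation I c z * perturbation I c' z \<partial>mu)"
    by (simp add: algebra_simps)
  also have "\<dots> = 1 + 0 + 0 + (\<Sum>i\<in>I. c i * c' i)"
    by (simp add: integral_perturbation integral_perturbation_mult prob_space[simplified])
  finally show ?thesis by simp
qed

lemma marginal_X_perturbed: "marginal_X (\<lambda>z. 1 + perturbation I c z) x = 1"
proof -
  interpret prob_space "cube_measure :: (real ^ 'dy) measure" by (rule prob_space_cube_measure)
  have "marginal_X (\<lambda>z. 1 + perturbation I c z) x
     = (\<integral>y. 1 + (\<Sum>i\<in>I. c i * fourier_basis (fst i) x * fourier_basis (snd i) y) \<partial>cube_measure)"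
    by (simp add: marginal_X_def perturbation_def tensor_basis_def mult_ac)
  also have "\<dots> = 1 + (\<Sum>i\<in>I. c i * fourier_basis (fst i) x * (\<integral>y. fourier_basis (snd i) y \<partial>cube_measure))"
    by (simp add: prob_space[simplified])
  also have "\<dots> = 1" using I_cases by (simp add: integral_fourier_basis)
  finally show ?thesis .
qed

lemma marginal_Y_perturbed: "marginal_Y (\<lambda>z. 1 + perturbation I c z) y = 1"
proof -
  interpret prob_space "cube_measure :: (real ^ 'dx) measure" by (rule prob_space_cube_measure)
  have "marginal_Y (\<lambda>z. 1 + perturbation I c z) y
     = (\<integral>x. 1 + (\<Sum>i\<in>I. c i * fourier_basis (snd i) y * fourier_basis (fst i) x) \<partial>cube_measure)"
    by (simp add: marginal_Y_def perturbation_def tensor_basis_def mult_ac)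
  also have "\<dots> = 1 + (\<Sum>i\<in>I. c i * fourier_basis (snd i) y * (\<integral>x. fourier_basis (fst i) x \<partial>cube_measure))"
    by (simp add: prob_space[simplified])
  also have "\<dots> = 1" using I_cases by (simp add: integral_fourier_basis)
  finally show ?thesis .
qed

lemma dependence_perturbed: "dependence (\<lambda>z. 1 + perturbation I c z) = (\<Sum>i\<in>I. (c i)\<^sup>2)"
  unfolding dependence_def marginal_X_perturbed marginal_Y_perturbed
  using integral_perturbation_mult(2)[of c c] by (simp add: power2_eq_square)

text \<open>The constant 1 contributes to \<open>coef\<close> only at \<open>(0, 0)\<close>, where the product of the marginal coefficients
  cancels it.\<close>

lemma coef_difference_perturbed:
  assumes jk: "j \<in> index_set" "k \<in> index_set"
  shows "coef (\<lambda>z. 1 + perturbation I c z) j k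
      - coef_X (\<lambda>z. 1 + perturbation I c z) j * coef_Y (\<lambda>z. 1 + perturbation I c z) k
    = (if (j, k) \<in> I then c (j, k) else 0)"
proof -
  have "coef (\<lambda>z. 1 + perturbation I c z) j k
      = (\<integral>z. tensor_basis j k z + perturbation I c z * tensor_basis j k z \<partial>mu)"
    by (simp add: coef_def algebra_simps)
  also have "\<dots> = (\<integral>z. tensor_basis j k z \<partial>mu) + (if (j, k) \<in> I then c (j, k) else 0)"
    using jk by (simp add: integral_perturbation_tensor_basis)
  also have "(\<integral>z. tensor_basis j k z \<partial>mu)
      = (\<integral>x. fourier_basis j x \<partial>cube_measure) * (\<integral>y. fourier_basis k y \<partial>cube_measure)"
    unfolding tensor_basis_def by (rule integral_mu_times) auto
  finally show ?thesis
    by (simp add: coef_X_def coef_Y_def marginal_X_perturbed marginal_Y_perturbed)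
qed

lemma smoothness_perturbed_le:
  assumes W: "\<And>j k. (j, k) \<in> I \<Longrightarrow> \<theta> j k \<le> ennreal W" and W0: "0 \<le> W"
  shows "smoothness \<theta> (\<lambda>z. 1 + perturbation I c z) \<le> ennreal (W\<^sup>2 * (\<Sum>i\<in>I. (c i)\<^sup>2))"
proof -
  have sub: "I \<subseteq> index_set \<times> index_set" using I_subset by auto
  have "smoothness \<theta> (\<lambda>z. 1 + perturbation I c z)
      = (\<Sum>\<^sub>\<infinity>(j, k)\<in>index_set \<times> index_set. (\<theta> j k)\<^sup>2 * ennreal ((if (j, k) \<in> I then c (j, k) else 0)\<^sup>2))"
    unfolding smoothness_def by (intro infsum_cong) (auto simp: coef_difference_perturbed)
  also have "\<dots> = (\<Sum>\<^sub>\<infinity>(j, k)\<in>I. (\<theta> j k)\<^sup>2 * ennreal ((c (j, k))\<^sup>2))"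
    using sub by (intro infsum_cong_neutral) auto
  also have "\<dots> = (\<Sum>(j, k)\<in>I. (\<theta> j k)\<^sup>2 * ennreal ((c (j, k))\<^sup>2))"
    using finite_I by (rule infsum_finite)
  also have "\<dots> \<le> (\<Sum>i\<in>I. ennreal (W\<^sup>2 * (c i)\<^sup>2))"
  proof (rule sum_mono, clarify)
    fix j k assume "(j, k) \<in> I"
    then have "(\<theta> j k)\<^sup>2 * ennreal ((c (j, k))\<^sup>2) \<le> (ennreal W)\<^sup>2 * ennreal ((c (j, k))\<^sup>2)"
      by (intro mult_right_mono power_mono W) auto
    then show "(\<theta> j k)\<^sup>2 * ennreal ((c (j, k))\<^sup>2) \<le> ennreal (W\<^sup>2 * (c (j, k))\<^sup>2)"
      using W0 by (simp add: ennreal_mult ennreal_power)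
  qed
  also have "\<dots> = ennreal (W\<^sup>2 * (\<Sum>i\<in>I. (c i)\<^sup>2))"
    by (subst sum_ennreal) (auto simp: sum_distrib_left)
  finally show ?thesis .
qed

lemma perturbed_in_alternatives:
  assumes W: "\<And>j k. (j, k) \<in> I \<Longrightarrow> \<theta> j k \<le> ennreal W" "0 \<le> W"
    and norm: "\<rho>\<^sup>2 \<le> (\<Sum>i\<in>I. (c i)\<^sup>2)" "W\<^sup>2 * (\<Sum>i\<in>I. (c i)\<^sup>2) \<le> r\<^sup>2"
    and sup: "\<And>z. z \<in> unit_cube \<times> unit_cube \<Longrightarrow> \<bar>perturbation I c z\<bar> \<le> min 1 (A - 1)"
  shows "(\<lambda>z. 1 + perturbation I c z) \<in> alternatives \<theta> r A \<rho>"
proof -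
  interpret prob_space "mu :: ((real ^ 'dx) \<times> (real ^ 'dy)) measure" by (rule prob_space_mu)
  have bnd: "0 \<le> 1 + perturbation I c z \<and> 1 + perturbation I c z \<le> A" if "z \<in> unit_cube \<times> unit_cube" for z
    using sup[OF that] by linarith
  obtain z0 :: "(real ^ 'dx) \<times> (real ^ 'dy)" where "z0 \<in> space mu" using not_empty by blast
  then have A1: "1 \<le> A" using sup[of z0] by auto
  have "(\<integral>\<^sup>+z. ennreal (1 + perturbation I c z) \<partial>mu) = ennreal (\<integral>z. 1 + perturbation I c z \<partial>mu)"
    using bnd by (intro nn_integral_eq_integral) auto
  also have "(\<integral>z. 1 + perturbation I c z \<partial>mu) = 1" by (simp add: integral_perturbation prob_space[simplified])
  also have "ennreal 1 = 1" by simp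
  finally have "(\<integral>\<^sup>+z. ennreal (1 + perturbation I c z) \<partial>mu) = 1" .
  moreover have "integrable mu (\<lambda>z. (1 + perturbation I c z)\<^sup>2)"
    using integral_perturbation_mult(1)[of c c] by (simp add: power2_sum flip: power2_eq_square)
  ultimately have dens: "(\<lambda>z. 1 + perturbation I c z) \<in> densities"
    using bnd by (auto simp: densities_def)
  have "sup_norm_on (unit_cube \<times> unit_cube) (\<lambda>z. 1 + perturbation I c z) \<le> ennreal A"
    unfolding sup_norm_on_def using bnd A1 by (intro SUP_least ennreal_leI) auto
  moreover have "sup_norm_on unit_cube (\<lambda>x :: real ^ 'dx. 1) \<le> ennreal A"
    and "sup_norm_on unit_cube (\<lambda>y :: real ^ 'dy. 1) \<le> ennreal A"
    unfolding sup_norm_on_def using A1 by (intro SUP_least ennreal_leI; simp)+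
  moreover have "smoothness \<theta> (\<lambda>z. 1 + perturbation I c z) \<le> ennreal (r\<^sup>2)"
    using smoothness_perturbed_le[OF W] norm(2) by (meson ennreal_leI order.trans)
  ultimately show ?thesis
    using dens norm(1)
    by (simp add: alternatives_def dependence_perturbed marginal_X_perturbed[abs_def] marginal_Y_perturbed[abs_def])
qed

end

section \<open>The supremum of a random perturbation\<close>

lemma abs_cos_diff_le: "\<bar>cos a - cos b\<bar> \<le> \<bar>a - b\<bar>" for a b :: real
proof -
  have "cos a - cos b = 2 * (sin ((a + b) / 2) * sin ((b - a) / 2))" by (simp add: cos_diff_cos)
  then have "\<bar>cos a - cos b\<bar> = 2 * (\<bar>sin ((a + b) / 2)\<bar> * \<bar>sin ((b - a) / 2)\<bar>)" by (simp add: abs_mult)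
  also have "\<dots> \<le> 2 * (1 * \<bar>(b - a) / 2\<bar>)"
    by (intro mult_left_mono mult_mono abs_sin_le_one abs_sin_x_le_abs_x) auto
  finally show ?thesis by simp
qed

lemma fourier_basis_lipschitz:
  assumes "\<And>l. \<bar>x $ l - y $ l\<bar> \<le> h"
  shows "\<bar>fourier_basis (a, m) x - fourier_basis (a, m) y\<bar> \<le> sqrt 2 * (2 * pi * l1_norm m * h)"
proof (cases "m = 0")
  case False
  let ?t = "\<lambda>x. 2 * pi * (\<Sum>l\<in>UNIV. real (m $ l) * x $ l) + real a * pi / 2"
  have "?t x - ?t y = 2 * pi * (\<Sum>l\<in>UNIV. real (m $ l) * (x $ l - y $ l))"
    by (simp add: sum_subtractf algebra_simps)
  then have "\<bar>?t x - ?t y\<bar> = 2 * pi * \<bar>\<Sum>l\<in>UNIV. real (m $ l) * (x $ l - y $ l)\<bar>"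
    by (simp add: abs_mult)
  also have "\<dots> \<le> 2 * pi * (\<Sum>l\<in>UNIV. real (m $ l) * h)"
    using assms by (intro mult_left_mono order.trans[OF sum_abs] sum_mono) (auto simp: abs_mult intro!: mult_left_mono)
  also have "\<dots> = 2 * pi * l1_norm m * h" by (simp add: l1_norm_def sum_distrib_right)
  finally have "\<bar>cos (?t x) - cos (?t y)\<bar> \<le> 2 * pi * l1_norm m * h"
    using abs_cos_diff_le[of "?t x" "?t y"] by linarith
  then show ?thesis using False
    by (simp add: fourier_basis_eq_cos abs_mult flip: right_diff_distrib)
qed (simp add: fourier_basis_def l1_norm_def)

text \<open>Lipschitz bounds are stated for the maximum distance of coordinates, as the grid controls
  each coordinate separately; the constant is then a multiple of the \<open>l1_norm\<close> of the frequencies.\<close>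

lemma tensor_basis_lipschitz:
  assumes "\<And>l. \<bar>fst z $ l - fst w $ l\<bar> \<le> h" "\<And>l. \<bar>snd z $ l - snd w $ l\<bar> \<le> h"
  shows "\<bar>tensor_basis j k z - tensor_basis j k w\<bar> \<le> 4 * pi * (l1_norm (snd j) + l1_norm (snd k)) * h"
proof -
  let ?p = "fourier_basis j" and ?q = "fourier_basis k"
  have "tensor_basis j k z - tensor_basis j k w
      = (?p (fst z) - ?p (fst w)) * ?q (snd z) + ?p (fst w) * (?q (snd z) - ?q (snd w))"
    by (simp add: tensor_basis_def algebra_simps)
  then have "\<bar>tensor_basis j k z - tensor_basis j k w\<bar>
      \<le> \<bar>?p (fst z) - ?p (fst w)\<bar> * \<bar>?q (snd z)\<bar> + \<bar>?p (fst w)\<bar> * \<bar>?q (snd z) - ?q (snd w)\<bar>"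
    by (metis abs_mult abs_triangle_ineq)
  also have "\<dots> \<le> sqrt 2 * (2 * pi * l1_norm (snd j) * h) * sqrt 2 + sqrt 2 * (sqrt 2 * (2 * pi * l1_norm (snd k) * h))"
    using fourier_basis_lipschitz[OF assms(1), of "fst j" "snd j"] fourier_basis_lipschitz[OF assms(2), of "fst k" "snd k"]
      order.trans[OF abs_ge_zero fourier_basis_lipschitz[OF assms(1), of "fst j" "snd j"]]
    by (intro add_mono mult_mono abs_fourier_basis_le) auto
  also have "\<dots> = 4 * pi * (l1_norm (snd j) + l1_norm (snd k)) * h" by (simp add: algebra_simps)
  finally show ?thesis .
qed

lemma card_vec_components:
  assumes "finite S"
  shows "finite {x :: 'a ^ 'd::finite. \<forall>l. x $ l \<in> S}"
    and "card {x :: 'a ^ 'd::finite. \<forall>l. x $ l \<in> S} = card S ^ CARD('d)"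
proof -
  have bij: "bij_betw vec_nth {x :: 'a ^ 'd. \<forall>l. x $ l \<in> S} (UNIV \<rightarrow>\<^sub>E S)"
    by (rule bij_betw_byWitness[where f' = vec_lambda]) (auto simp: PiE_iff)
  have "finite ((UNIV :: 'd set) \<rightarrow>\<^sub>E S)" using assms by (intro finite_PiE) auto
  then show "finite {x :: 'a ^ 'd::finite. \<forall>l. x $ l \<in> S}"
    using bij_betw_finite[OF bij] by simp
  show "card {x :: 'a ^ 'd::finite. \<forall>l. x $ l \<in> S} = card S ^ CARD('d)"
    using bij_betw_same_card[OF bij] by (simp add: card_PiE)
qed

definition cube_grid :: "nat \<Rightarrow> (real ^ 'd::finite) set" where
  "cube_grid L = {x. \<forall>l. x $ l \<in> (\<lambda>i. real i / real L) ` {..L}}"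

lemma finite_cube_grid: "finite (cube_grid L)"
  unfolding cube_grid_def by (rule card_vec_components) simp

lemma card_cube_grid_le: "card (cube_grid L :: (real ^ 'd::finite) set) \<le> (L + 1) ^ CARD('d)"
proof -
  have "card ((\<lambda>i. real i / real L) ` {..L}) \<le> L + 1"
    using card_image_le[of "{..L}"] by simp
  then show ?thesis unfolding cube_grid_def by (subst card_vec_components) (auto intro: power_mono)
qed

lemma cube_grid_approx:
  fixes x :: "real ^ 'd::finite"
  assumes "0 < L" "x \<in> unit_cube"
  obtains g where "g \<in> cube_grid L" "\<And>l. \<bar>x $ l - g $ l\<bar> \<le> 1 / real L"
proof
  define k where "k = (\<lambda>l. nat \<lfloor>real L * x $ l\<rfloor>)"
  have k: "real (k l) \<le> real L * x $ l" "real L * x $ l < real (k l) + 1" for l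
  proof -
    have "0 \<le> real L * x $ l" using assms by (auto simp: unit_cube_def)
    then show "real (k l) \<le> real L * x $ l" "real L * x $ l < real (k l) + 1"
      unfolding k_def by linarith+
  qed
  have "k l \<le> L" for l
  proof -
    have "real L * x $ l \<le> real L * 1" using assms by (intro mult_left_mono) (auto simp: unit_cube_def)
    then show ?thesis using k(1)[of l] by simp
  qed
  then show "(\<chi> l. real (k l) / real L) \<in> (cube_grid L :: (real ^ 'd) set)" by (auto simp: cube_grid_def)
  show "\<bar>x $ l - (\<chi> l. real (k l) / real L) $ l\<bar> \<le> 1 / real L" for l
  proof -
    have "x $ l - (\<chi> l. real (k l) / real L) $ l = (real L * x $ l - real (k l)) / real L"
      using \<open>0 < L\<close> by (simp add: diff_divide_distrib)
    then show ?thesis using k[of l] by (simp add: divide_right_mono)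
  qed
qed

lemma perturbation_lipschitz:
  assumes "\<And>l. \<bar>fst z $ l - fst w $ l\<bar> \<le> h" "\<And>l. \<bar>snd z $ l - snd w $ l\<bar> \<le> h"
    and c: "\<And>i. i \<in> I \<Longrightarrow> \<bar>c i\<bar> \<le> \<eta>"
    and m: "\<And>i. i \<in> I \<Longrightarrow> l1_norm (snd (fst i)) + l1_norm (snd (snd i)) \<le> m" and "0 \<le> h"
  shows "\<bar>perturbation I c z - perturbation I c w\<bar> \<le> real (card I) * (\<eta> * (4 * pi * m * h))"
proof -
  have "\<bar>perturbation I c z - perturbation I c w\<bar>
     = \<bar>\<Sum>i\<in>I. c i * (tensor_basis (fst i) (snd i) z - tensor_basis (fst i) (snd i) w)\<bar>"
    by (simp add: perturbation_def sum_subtractf right_diff_distrib)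
  also have "\<dots> \<le> (\<Sum>i\<in>I. \<eta> * (4 * pi * m * h))"
  proof (rule order.trans[OF sum_abs sum_mono])
    fix i assume i: "i \<in> I"
    have "\<bar>tensor_basis (fst i) (snd i) z - tensor_basis (fst i) (snd i) w\<bar>
        \<le> 4 * pi * (l1_norm (snd (fst i)) + l1_norm (snd (snd i))) * h"
      by (rule tensor_basis_lipschitz) fact+
    also have "\<dots> \<le> 4 * pi * m * h"
      using m[OF i] \<open>0 \<le> h\<close> by (intro mult_right_mono mult_left_mono) auto
    finally show "\<bar>c i * (tensor_basis (fst i) (snd i) z - tensor_basis (fst i) (snd i) w)\<bar> \<le> \<eta> * (4 * pi * m * h)"
      unfolding abs_mult using c[OF i] by (intro mult_mono) auto
  qed
  finally show ?thesis by simp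
qed

definition signed_perturbation ::
  "('dx::finite index \<times> 'dy::finite index) set \<Rightarrow> real \<Rightarrow> ('dx index \<times> 'dy index \<Rightarrow> real) \<Rightarrow> (real ^ 'dx) \<times> (real ^ 'dy) \<Rightarrow> real"
  where "signed_perturbation I \<eta> \<epsilon> = perturbation I (\<lambda>i. \<eta> * \<epsilon> i)"

text \<open>If the absolute value of the perturbation exceeds \<open>b\<close> somewhere, then it exceeds \<open>b / 2\<close> at a neighbouring grid point, because
  the mesh is fine enough for the Lipschitz constant. At each grid point Hoeffding's inequality
  applies with variance proxy \<open>4 * \<eta>\<^sup>2 * card I\<close>, the basis functions being bounded by 2.\<close>

lemma card_large_signed_perturbations_le:
  fixes I :: "('dx::finite index \<times> 'dy::finite index) set"
  assumes fin: "finite I" and ne: "I \<noteq> {}" and "0 < \<eta>" "0 < L" "0 < b"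
    and m: "\<And>i. i \<in> I \<Longrightarrow> l1_norm (snd (fst i)) + l1_norm (snd (snd i)) \<le> m"
    and mesh: "real (card I) * \<eta> * (8 * pi * m) \<le> b * real L"
  shows "real (card {\<epsilon> \<in> sign_vectors I. \<exists>z\<in>unit_cube \<times> unit_cube. b < \<bar>signed_perturbation I \<eta> \<epsilon> z\<bar>})
    \<le> 2 * real (L + 1) ^ (CARD('dx) + CARD('dy)) * exp (- b\<^sup>2 / (32 * (\<eta>\<^sup>2 * real (card I)))) * 2 ^ card I"
proof -
  let ?grid = "cube_grid L \<times> cube_grid L :: ((real ^ 'dx) \<times> (real ^ 'dy)) set"
  let ?large = "\<lambda>w. {\<epsilon> \<in> sign_vectors I. b / 2 < \<bar>\<Sum>i\<in>I. \<epsilon> i * (\<eta> * tensor_basis (fst i) (snd i) w)\<bar>}"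
  let ?e = "2 * 2 ^ card I * exp (- (b / 2)\<^sup>2 / (2 * (4 * \<eta>\<^sup>2 * real (card I))))"
  have N: "0 < real (card I)" using fin ne by (simp add: card_gt_0_iff)
  have signed: "signed_perturbation I \<eta> \<epsilon> w = (\<Sum>i\<in>I. \<epsilon> i * (\<eta> * tensor_basis (fst i) (snd i) w))" for \<epsilon> w
    by (simp add: signed_perturbation_def perturbation_def mult_ac)
  have sub: "{\<epsilon> \<in> sign_vectors I. \<exists>z\<in>unit_cube \<times> unit_cube. b < \<bar>signed_perturbation I \<eta> \<epsilon> z\<bar>}
      \<subseteq> (\<Union>w\<in>?grid. ?large w)"
  proof clarify
    fix \<epsilon> x y assume \<epsilon>: "\<epsilon> \<in> sign_vectors I" and xy: "x \<in> unit_cube" "y \<in> unit_cube"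
      and large: "b < \<bar>signed_perturbation I \<eta> \<epsilon> (x, y)\<bar>"
    obtain g where g: "g \<in> cube_grid L" "\<And>l. \<bar>x $ l - g $ l\<bar> \<le> 1 / real L"
      using cube_grid_approx[OF \<open>0 < L\<close> xy(1)] by blast
    obtain h where h: "h \<in> cube_grid L" "\<And>l. \<bar>y $ l - h $ l\<bar> \<le> 1 / real L"
      using cube_grid_approx[OF \<open>0 < L\<close> xy(2)] by blast
    have "\<bar>signed_perturbation I \<eta> \<epsilon> (x, y) - signed_perturbation I \<eta> \<epsilon> (g, h)\<bar>
        \<le> real (card I) * (\<eta> * (4 * pi * m * (1 / real L)))"
      unfolding signed_perturbation_def using g h m \<open>0 < \<eta>\<close> abs_sign_vectors[OF \<epsilon>]
      by (intro perturbation_lipschitz) (auto simp: abs_mult)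
    also have "\<dots> \<le> b / 2" using mesh \<open>0 < L\<close> by (simp add: field_simps)
    finally have "b / 2 < \<bar>signed_perturbation I \<eta> \<epsilon> (g, h)\<bar>" using large by linarith
    then show "\<epsilon> \<in> (\<Union>w\<in>?grid. ?large w)" using g h \<epsilon> by (auto simp: signed)
  qed
  have large: "real (card (?large w)) \<le> ?e" for w
  proof (rule card_sign_vectors_large_le)
    have "(\<Sum>i\<in>I. (\<eta> * tensor_basis (fst i) (snd i) w)\<^sup>2) \<le> (\<Sum>i\<in>I. \<eta>\<^sup>2 * 2\<^sup>2)"
      unfolding power_mult_distrib by (intro sum_mono mult_left_mono) (auto simp: tensor_basis_square_le)
    then show "(\<Sum>i\<in>I. (\<eta> * tensor_basis (fst i) (snd i) w)\<^sup>2) \<le> 4 * \<eta>\<^sup>2 * real (card I)" by (simp add: mult_ac)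
  qed (use N fin \<open>0 < \<eta>\<close> \<open>0 < b\<close> in auto)
  have fin_grid: "finite ?grid" by (simp add: finite_cube_grid)
  have "card {\<epsilon> \<in> sign_vectors I. \<exists>z\<in>unit_cube \<times> unit_cube. b < \<bar>signed_perturbation I \<eta> \<epsilon> z\<bar>}
      \<le> card (\<Union>w\<in>?grid. ?large w)"
    using sub fin fin_grid by (intro card_mono) auto
  also have "\<dots> \<le> (\<Sum>w\<in>?grid. card (?large w))" by (rule card_UN_le[OF fin_grid])
  finally have "real (card {\<epsilon> \<in> sign_vectors I. \<exists>z\<in>unit_cube \<times> unit_cube. b < \<bar>signed_perturbation I \<eta> \<epsilon> z\<bar>})
      \<le> real (\<Sum>w\<in>?grid. card (?large w))" by (rule of_nat_mono)
  also have "\<dots> = (\<Sum>w\<in>?grid. real (card (?large w)))" by (rule of_nat_sum)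
  also have "\<dots> \<le> (\<Sum>w\<in>?grid. ?e)" by (intro sum_mono large)
  also have "\<dots> = real (card ?grid) * ?e" by simp
  also have "\<dots> \<le> real (L + 1) ^ (CARD('dx) + CARD('dy)) * ?e"
  proof (intro mult_right_mono)
    have "card ?grid \<le> (L + 1) ^ CARD('dx) * (L + 1) ^ CARD('dy)"
      unfolding card_cartesian_product by (intro mult_mono card_cube_grid_le) auto
    then have "real (card ?grid) \<le> real ((L + 1) ^ CARD('dx) * (L + 1) ^ CARD('dy))" by (rule of_nat_mono)
    then show "real (card ?grid) \<le> real (L + 1) ^ (CARD('dx) + CARD('dy))" by (simp add: power_add)
  qed simp
  also have "- (b / 2)\<^sup>2 / (2 * (4 * \<eta>\<^sup>2 * real (card I))) = - b\<^sup>2 / (32 * (\<eta>\<^sup>2 * real (card I)))"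
    by (simp add: power_divide)
  finally show ?thesis by (simp add: mult_ac)
qed

section \<open>The minimax risk of a random alternative\<close>

text \<open>The prior is uniform on the set \<open>G\<close> of those signs for which the perturbation is at most \<open>b\<close> in absolute value. The bound
  \<open>rare\<close> leaves at least the fraction \<open>1 - \<delta>\<close> of all signs in \<open>G\<close>. In the second moment, one of the two
  signs may therefore be averaged over all sign vectors at the price of a factor \<open>1 / (1 - \<delta>)\<close>, and
  the average over all of them is explicit.\<close>

lemma minimax_risk_lower_bound:
  fixes I :: "('dx::finite index \<times> 'dy::finite index) set"
  assumes I: "nonconstant_frequencies I" and ne: "I \<noteq> {}"
    and pos: "0 < \<eta>" "0 < L" "0 < b" "0 < \<tau>"
    and b: "b \<le> 1" "b \<le> A - 1"
    and W: "\<And>j k. (j, k) \<in> I \<Longrightarrow> \<theta> j k \<le> ennreal W" "0 \<le> W"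
    and sobolev: "W\<^sup>2 * (\<eta>\<^sup>2 * real (card I)) \<le> r\<^sup>2"
    and separation: "\<rho>\<^sup>2 \<le> \<eta>\<^sup>2 * real (card I)"
    and m: "\<And>i. i \<in> I \<Longrightarrow> l1_norm (snd (fst i)) + l1_norm (snd (snd i)) \<le> m"
    and mesh: "real (card I) * \<eta> * (8 * pi * m) \<le> b * real L"
    and rare: "2 * real (L + 1) ^ (CARD('dx) + CARD('dy)) * exp (- b\<^sup>2 / (32 * (\<eta>\<^sup>2 * real (card I)))) \<le> \<delta>"
    and \<delta>: "\<delta> < 1"
    and chi_square: "exp ((real n * \<eta>\<^sup>2)\<^sup>2 * real (card I) / 2) \<le> (1 + \<tau>\<^sup>2) * (1 - \<delta>)"
  shows "ennreal (1 - \<tau>) \<le> minimax_risk n \<theta> r A \<rho>"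
proof -
  interpret nonconstant_frequencies I by fact
  interpret prob_space "mu :: ((real ^ 'dx) \<times> (real ^ 'dy)) measure" by (rule prob_space_mu)
  let ?large = "{\<epsilon> \<in> sign_vectors I. \<exists>z\<in>unit_cube \<times> unit_cube. b < \<bar>signed_perturbation I \<eta> \<epsilon> z\<bar>}"
  define G where "G = sign_vectors I - ?large"
  define F where "F = (\<lambda>\<epsilon> z. 1 + signed_perturbation I \<eta> \<epsilon> z)"
  have fin: "finite (sign_vectors I)" using finite_I by simp
  have finG: "finite G" unfolding G_def using fin by simp
  have "real (card ?large) \<le> \<delta> * 2 ^ card I"
    by (rule order.trans[OF card_large_signed_perturbations_le[OF finite_I ne pos(1,2,3) m mesh]])
      (assumption, rule mult_right_mono[OF rare], simp)
  moreover have "card G = card (sign_vectors I) - card ?large"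
    unfolding G_def using fin by (intro card_Diff_subset) (auto intro: finite_subset)
  then have "real (card (sign_vectors I)) - real (card ?large) \<le> real (card G)" by linarith
  ultimately have cardG: "(1 - \<delta>) * 2 ^ card I \<le> real (card G)"
    by (simp add: card_sign_vectors[OF finite_I] left_diff_distrib)
  have neG: "G \<noteq> {}"
  proof -
    have "0 < (1 - \<delta>) * 2 ^ card I" using \<delta> by simp
    then show ?thesis using cardG by auto
  qed
  have sup: "\<bar>signed_perturbation I \<eta> \<epsilon> z\<bar> \<le> b" if "\<epsilon> \<in> G" "z \<in> unit_cube \<times> unit_cube" for \<epsilon> z
    using that by (force simp: G_def)
  have sq: "(\<Sum>i\<in>I. (\<eta> * \<epsilon> i)\<^sup>2) = \<eta>\<^sup>2 * real (card I)" if "\<epsilon> \<in> G" for \<epsilon>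
  proof -
    have "(\<epsilon> i)\<^sup>2 = 1" if "i \<in> I" for i
      using abs_sign_vectors[of \<epsilon> I i] \<open>\<epsilon> \<in> G\<close> that by (simp add: G_def power2_eq_1_iff abs_if split: if_splits)
    then show ?thesis by (simp add: power_mult_distrib)
  qed
  have F_alt: "F \<epsilon> \<in> alternatives \<theta> r A \<rho>" if "\<epsilon> \<in> G" for \<epsilon>
    unfolding F_def signed_perturbation_def
  proof (rule perturbed_in_alternatives[OF W])
    fix z :: "(real ^ 'dx) \<times> (real ^ 'dy)" assume "z \<in> unit_cube \<times> unit_cube"
    from sup[OF \<open>\<epsilon> \<in> G\<close> this] show "\<bar>perturbation I (\<lambda>i. \<eta> * \<epsilon> i) z\<bar> \<le> min 1 (A - 1)"
      using b by (simp add: signed_perturbation_def)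
  qed (use sq[OF that] sobolev separation in auto)
  have F_meas: "F \<epsilon> \<in> borel_measurable mu" for \<epsilon>
    unfolding F_def signed_perturbation_def by measurable
  have F_bnd: "0 \<le> F \<epsilon> z \<and> F \<epsilon> z \<le> A" if "\<epsilon> \<in> G" "z \<in> space mu" for \<epsilon> z
    using sup[of \<epsilon> z] that b by (auto simp: F_def)
  have F_int: "(\<integral>z. F \<epsilon> z \<partial>mu) = 1" for \<epsilon>
    unfolding F_def signed_perturbation_def by (simp add: integral_perturbation prob_space[simplified])
  have inner: "(\<integral>z. F \<epsilon> z * F \<epsilon>' z \<partial>mu) = 1 + (\<Sum>i\<in>I. \<epsilon>' i * (\<eta>\<^sup>2 * \<epsilon> i))" for \<epsilon> \<epsilon>'
    unfolding F_def signed_perturbation_def integral_perturbed_mult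
    by (simp add: power2_eq_square mult_ac)
  have "(\<Sum>\<epsilon>'\<in>G. (\<integral>z. F \<epsilon> z * F \<epsilon>' z \<partial>mu) ^ n) \<le> (1 + \<tau>\<^sup>2) * real (card G)" if \<epsilon>: "\<epsilon> \<in> G" for \<epsilon>
  proof -
    have "(\<Sum>\<epsilon>'\<in>G. (\<integral>z. F \<epsilon> z * F \<epsilon>' z \<partial>mu) ^ n) \<le> (\<Sum>\<epsilon>'\<in>G. exp (\<Sum>i\<in>I. \<epsilon>' i * (real n * (\<eta>\<^sup>2 * \<epsilon> i))))"
    proof (rule sum_mono)
      fix \<epsilon>' assume \<epsilon>': "\<epsilon>' \<in> G"
      have "0 \<le> (\<integral>z. F \<epsilon> z * F \<epsilon>' z \<partial>mu)"
        using F_bnd \<epsilon> \<epsilon>' by (intro Bochner_Integration.integral_nonneg) auto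
      moreover have "(\<integral>z. F \<epsilon> z * F \<epsilon>' z \<partial>mu) \<le> exp (\<Sum>i\<in>I. \<epsilon>' i * (\<eta>\<^sup>2 * \<epsilon> i))"
        unfolding inner by (rule exp_ge_add_one_self)
      ultimately have "(\<integral>z. F \<epsilon> z * F \<epsilon>' z \<partial>mu) ^ n \<le> exp (\<Sum>i\<in>I. \<epsilon>' i * (\<eta>\<^sup>2 * \<epsilon> i)) ^ n"
        by (intro power_mono)
      also have "\<dots> = exp (\<Sum>i\<in>I. \<epsilon>' i * (real n * (\<eta>\<^sup>2 * \<epsilon> i)))"
        by (simp add: sum_distrib_left mult_ac flip: exp_of_nat_mult)
      finally show "(\<integral>z. F \<epsilon> z * F \<epsilon>' z \<partial>mu) ^ n \<le> exp (\<Sum>i\<in>I. \<epsilon>' i * (real n * (\<eta>\<^sup>2 * \<epsilon> i)))" .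
    qed
    also have "\<dots> \<le> (\<Sum>\<epsilon>'\<in>sign_vectors I. exp (\<Sum>i\<in>I. \<epsilon>' i * (real n * (\<eta>\<^sup>2 * \<epsilon> i))))"
      using fin by (intro sum_mono2) (auto simp: G_def)
    also have "\<dots> \<le> 2 ^ card I * exp ((\<Sum>i\<in>I. (real n * (\<eta>\<^sup>2 * \<epsilon> i))\<^sup>2) / 2)"
      by (rule sum_sign_vectors_exp_le[OF finite_I])
    also have "(\<Sum>i\<in>I. (real n * (\<eta>\<^sup>2 * \<epsilon> i))\<^sup>2) = (real n * \<eta>)\<^sup>2 * (\<Sum>i\<in>I. (\<eta> * \<epsilon> i)\<^sup>2)"
      by (simp add: sum_distrib_left power_mult_distrib power2_eq_square mult_ac)
    also have "\<dots> = (real n * \<eta>\<^sup>2)\<^sup>2 * real (card I)"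
      unfolding sq[OF \<epsilon>] by (simp add: power2_eq_square mult_ac)
    also have "2 ^ card I * exp ((real n * \<eta>\<^sup>2)\<^sup>2 * real (card I) / 2) \<le> 2 ^ card I * ((1 + \<tau>\<^sup>2) * (1 - \<delta>))"
      by (intro mult_left_mono chi_square) auto
    also have "\<dots> = (1 + \<tau>\<^sup>2) * ((1 - \<delta>) * 2 ^ card I)" by simp
    also have "\<dots> \<le> (1 + \<tau>\<^sup>2) * real (card G)" by (intro mult_left_mono cardG) auto
    finally show ?thesis .
  qed
  then have "(\<Sum>\<epsilon>\<in>G. \<Sum>\<epsilon>'\<in>G. (\<integral>z. F \<epsilon> z * F \<epsilon>' z \<partial>mu) ^ n) \<le> (\<Sum>\<epsilon>\<in>G. (1 + \<tau>\<^sup>2) * real (card G))"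
    by (rule sum_mono)
  also have "\<dots> = (1 + \<tau>\<^sup>2) * (real (card G))\<^sup>2" by (simp add: power2_eq_square)
  finally have second_moment: "(\<Sum>\<epsilon>\<in>G. \<Sum>\<epsilon>'\<in>G. (\<integral>z. F \<epsilon> z * F \<epsilon>' z \<partial>mu) ^ n) \<le> (1 + \<tau>\<^sup>2) * (real (card G))\<^sup>2" .
  show ?thesis
    unfolding minimax_risk_def
  proof (rule INF_greatest)
    fix \<psi> :: "(nat \<Rightarrow> (real ^ 'dx) \<times> (real ^ 'dy)) \<Rightarrow> real" assume \<psi>: "\<psi> \<in> tests n"
    then have \<psi>01: "0 \<le> \<psi> \<omega> \<and> \<psi> \<omega> \<le> 1" if "\<omega> \<in> space (Pi\<^sub>M {..<n} (\<lambda>_. mu))" for \<omega>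
      using that by (auto simp: tests_def)
    have "\<exists>\<epsilon>\<in>G. 1 - \<tau> \<le> (\<integral>\<omega>. \<psi> \<omega> \<partial>Pi\<^sub>M {..<n} (\<lambda>_. mu)) + expect n (F \<epsilon>) (\<lambda>\<omega>. 1 - \<psi> \<omega>)"
      unfolding expect_def
    proof (rule mixture_testing_bound[OF finG neG F_meas _ F_int second_moment pos(4)])
      show "\<psi> \<in> borel_measurable (Pi\<^sub>M {..<n} (\<lambda>_. mu))" using \<psi> by (simp add: tests_def)
    qed (rule F_bnd \<psi>01, assumption+)+
    then obtain \<epsilon> where \<epsilon>: "\<epsilon> \<in> G"
      and risk: "1 - \<tau> \<le> (\<integral>\<omega>. \<psi> \<omega> \<partial>Pi\<^sub>M {..<n} (\<lambda>_. mu)) + expect n (F \<epsilon>) (\<lambda>\<omega>. 1 - \<psi> \<omega>)"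
      by blast
    have one: "expect n (tensor_basis (0, 0) (0, 0)) \<psi> = (\<integral>\<omega>. \<psi> \<omega> \<partial>Pi\<^sub>M {..<n} (\<lambda>_. mu))"
      by (simp add: expect_def tensor_basis_def density_1)
    have space: "space (Pi\<^sub>M {..<n} (\<lambda>_. density mu (\<lambda>z. ennreal (f z)))) = space (Pi\<^sub>M {..<n} (\<lambda>_. mu))"
      for f :: "(real ^ 'dx) \<times> (real ^ 'dy) \<Rightarrow> real"
      by (simp add: space_PiM)
    have "0 \<le> (\<integral>\<omega>. \<psi> \<omega> \<partial>Pi\<^sub>M {..<n} (\<lambda>_. mu))"
      using \<psi>01 by (intro Bochner_Integration.integral_nonneg) auto
    moreover have "0 \<le> expect n (F \<epsilon>) (\<lambda>\<omega>. 1 - \<psi> \<omega>)"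
      unfolding expect_def using \<psi>01 space[of "F \<epsilon>"] by (intro Bochner_Integration.integral_nonneg) auto
    ultimately have "ennreal (1 - \<tau>) \<le> ennreal (expect n (tensor_basis (0, 0) (0, 0)) \<psi>) + ennreal (expect n (F \<epsilon>) (\<lambda>\<omega>. 1 - \<psi> \<omega>))"
      using risk by (simp add: one ennreal_leI flip: ennreal_plus)
    also have "\<dots> \<le> ennreal (expect n (tensor_basis (0, 0) (0, 0)) \<psi>)
        + (SUP f\<in>alternatives \<theta> r A \<rho>. ennreal (expect n f (\<lambda>\<omega>. 1 - \<psi> \<omega>)))"
      by (intro add_left_mono SUP_upper F_alt \<epsilon>)
    finally show "ennreal (1 - \<tau>) \<le> \<dots>" .
  qed
qed

text \<open>The first component 0 selects cosines. Positive coordinates keep \<open>(0, 0)\<close> out and still leave as many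
  indices as a full cube of side \<open>K\<close>.\<close>

definition positive_frequencies :: "nat \<Rightarrow> 'd::finite index set" where
  "positive_frequencies K = Pair 0 ` {m. \<forall>l. m $ l \<in> {1..K}}"

lemma finite_positive_frequencies: "finite (positive_frequencies K)"
  unfolding positive_frequencies_def by (intro finite_imageI card_vec_components) simp

lemma card_positive_frequencies: "card (positive_frequencies K :: 'd::finite index set) = K ^ CARD('d)"
  unfolding positive_frequencies_def using card_vec_components(2)[of "{1..K}"]
  by (simp add: card_image inj_on_def)

lemma positive_frequencies_subset: "positive_frequencies K \<subseteq> index_set - {(0, 0)}"
  by (auto simp: positive_frequencies_def index_set_def vec_eq_iff)

lemma l1_norm_positive_frequencies:
  fixes j :: "'d::finite index"
  assumes "j \<in> positive_frequencies K"
  shows "l1_norm (snd j) \<le> real CARD('d) * real K"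
proof -
  have "(\<Sum>l\<in>UNIV. real (snd j $ l)) \<le> (\<Sum>l\<in>(UNIV :: 'd set). real K)"
    using assms by (intro sum_mono) (auto simp: positive_frequencies_def)
  then show ?thesis by (simp add: l1_norm_def)
qed

lemma powr_mult_weight_le:
  assumes "real K \<le> 2 * T powr (1 / a)" "0 < a" "0 \<le> T"
  shows "(real D * real K) powr a \<le> (2 * real D) powr a * T"
proof -
  have "(real D * real K) powr a \<le> (2 * real D * T powr (1 / a)) powr a"
    using assms by (intro powr_mono2) (auto simp: mult_left_mono mult_ac)
  also have "\<dots> = (2 * real D) powr a * T"
    using assms by (simp add: powr_mult powr_powr)
  finally show ?thesis .
qed

lemma sobolev_weight_positive_frequencies_le:
  fixes j :: "'dx::finite index" and k :: "'dy::finite index"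
  assumes jk: "j \<in> positive_frequencies KX" "k \<in> positive_frequencies KY"
    and K: "real KX \<le> 2 * T powr (1 / sX)" "real KY \<le> 2 * T powr (1 / sY)"
    and pos: "0 < sX" "0 < sY" "0 \<le> T"
  shows "sobolev_weight sX sY j k
    \<le> ennreal (max ((2 * real CARD('dx)) powr sX) ((2 * real CARD('dy)) powr sY) * T)"
proof -
  let ?C = "max ((2 * real CARD('dx)) powr sX) ((2 * real CARD('dy)) powr sY)"
  have "l1_norm (snd j) powr sX \<le> (real CARD('dx) * real KX) powr sX"
    using l1_norm_positive_frequencies[OF jk(1)] pos
    by (intro powr_mono2) (auto simp: l1_norm_def sum_nonneg)
  also have "\<dots> \<le> (2 * real CARD('dx)) powr sX * T" by (intro powr_mult_weight_le K pos)
  also have "\<dots> \<le> ?C * T" using pos by (intro mult_right_mono) auto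
  finally have X: "l1_norm (snd j) powr sX \<le> ?C * T" .
  have "l1_norm (snd k) powr sY \<le> (real CARD('dy) * real KY) powr sY"
    using l1_norm_positive_frequencies[OF jk(2)] pos
    by (intro powr_mono2) (auto simp: l1_norm_def sum_nonneg)
  also have "\<dots> \<le> (2 * real CARD('dy)) powr sY * T" by (intro powr_mult_weight_le K pos)
  also have "\<dots> \<le> ?C * T" using pos by (intro mult_right_mono) auto
  finally have Y: "l1_norm (snd k) powr sY \<le> ?C * T" .
  show ?thesis
    using jk X Y positive_frequencies_subset[of KX] positive_frequencies_subset[of KY]
    by (auto simp: sobolev_weight_def intro!: ennreal_leI)
qed

section \<open>The separation rate\<close>

text \<open>The frequency scale \<open>T\<close> solves the two balance equations of the lower bound: a perturbation of norm \<open>R\<close>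
  with weights of order \<open>T\<close> exhausts the Sobolev radius \<open>r\<close>, and with \<open>T powr (D / s)\<close> coefficients it
  stays at the detection threshold for sample size \<open>x\<close>.\<close>

lemma rate_identities:
  fixes x r s D :: real
  assumes pos: "0 < x" "0 < r" "0 < s" "0 < D"
  defines "R \<equiv> (r powr D / x powr (2 * s)) powr (1 / (4 * s + D))"
    and "T \<equiv> (x * r\<^sup>2) powr (2 * s / (4 * s + D))"
  shows "R * T = r" and "x\<^sup>2 * R ^ 4 = T powr (D / s)"
proof -
  let ?a = "ln x" and ?b = "ln r" and ?q = "4 * s + D"
  have q: "?q \<noteq> 0" using pos by simp
  have R: "R = exp ((D * ?b - 2 * s * ?a) / ?q)"
    using pos by (simp add: R_def powr_def exp_diff[symmetric])
  have T: "T = exp (2 * s * (?a + 2 * ?b) / ?q)"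
    using pos by (simp add: T_def powr_def ln_mult ln_realpow)
  have "R * T = exp ((D * ?b - 2 * s * ?a) / ?q + 2 * s * (?a + 2 * ?b) / ?q)"
    by (simp add: R T exp_add)
  also have "(D * ?b - 2 * s * ?a) / ?q + 2 * s * (?a + 2 * ?b) / ?q = ?b"
    using q by (simp add: nonzero_divide_eq_eq algebra_simps flip: add_divide_distrib)
  finally show "R * T = r" using pos by simp
  have "x\<^sup>2 * R ^ 4 = exp (2 * ?a + 4 * ((D * ?b - 2 * s * ?a) / ?q))"
  proof -
    have "R ^ 4 = exp (4 * ((D * ?b - 2 * s * ?a) / ?q))"
      unfolding R by (subst exp_of_nat_mult[symmetric]) simp
    moreover have "x\<^sup>2 = exp (2 * ?a)" using pos by (simp add: exp_double)
    ultimately show ?thesis by (simp add: exp_add)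
  qed
  also have "2 * ?a + 4 * ((D * ?b - 2 * s * ?a) / ?q) = D / s * (2 * s * (?a + 2 * ?b) / ?q)"
    using q pos by (simp add: divide_simps) (simp add: algebra_simps)
  also have "exp \<dots> = T powr (D / s)"
    by (simp add: T powr_def)
  finally show "x\<^sup>2 * R ^ 4 = T powr (D / s)" .
qed

text \<open>Since \<open>c\<^sup>2\<close> and \<open>c ^ 4\<close> are at most \<open>c\<close> for \<open>c \<le> 1\<close>, it suffices to satisfy linear conditions.\<close>

lemma small_constant_exists:
  fixes C P v w :: real
  assumes "0 \<le> C" "0 \<le> P" "0 < v" "0 < w"
  obtains c where "0 < c" "c \<le> 1" "C * c \<le> 1" "c ^ 4 / 2 \<le> v" "P * c\<^sup>2 \<le> w"
proof
  define c where "c = Min {1, 1 / (C + 1), v, w / (P + 1)}"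
  have c: "c \<le> 1" "c \<le> 1 / (C + 1)" "c \<le> v" "c \<le> w / (P + 1)" by (simp_all add: c_def)
  show "0 < c" "c \<le> 1" using assms by (simp_all add: c_def)
  have le: "(C + 1) * c \<le> 1" "(P + 1) * c \<le> w"
    using c assms by (simp_all add: pos_le_divide_eq mult.commute)
  then show "C * c \<le> 1" using \<open>0 < c\<close> by (simp add: distrib_right)
  have "c\<^sup>2 \<le> c" "c ^ 4 \<le> c"
    using power_decreasing[of 1 2 c] power_decreasing[of 1 4 c] \<open>0 < c\<close> c by simp_all
  then show "c ^ 4 / 2 \<le> v" using c \<open>0 < c\<close> by linarith
  have "P * c\<^sup>2 \<le> P * c" using \<open>c\<^sup>2 \<le> c\<close> assms by (intro mult_left_mono)
  then show "P * c\<^sup>2 \<le> w" using le \<open>0 < c\<close> by (simp add: distrib_right)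
qed

lemma ceiling_between:
  fixes t :: real
  assumes "1 \<le> t"
  shows "t \<le> real (nat \<lceil>t\<rceil>)" "real (nat \<lceil>t\<rceil>) \<le> 2 * t" "0 < nat \<lceil>t\<rceil>"
  using assms by linarith+


lemma separation_radius_geI:
  assumes "\<And>\<rho>. 0 < \<rho> \<Longrightarrow> \<rho> \<le> \<rho>0 \<Longrightarrow> ennreal \<gamma> < minimax_risk n \<theta> r A \<rho>"
  shows "ennreal \<rho>0 \<le> separation_radius n \<gamma> \<theta> r A"
  unfolding separation_radius_def
proof (rule Inf_greatest, clarify)
  fix \<rho> :: real assume "0 < \<rho>" "minimax_risk n \<theta> r A \<rho> \<le> ennreal \<gamma>"
  then have "\<rho>0 < \<rho>" using assms[of \<rho>] by (meson leD not_le)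
  then show "ennreal \<rho>0 \<le> ennreal \<rho>" by (intro ennreal_leI) simp
qed

theorem proposition14:
  fixes sX sY A \<gamma> s :: real and d :: nat
  assumes "0 < sX" and "0 < sY" and "1 < A" and "0 < \<gamma>" and "\<gamma> < 1"
    and d: "d = CARD('dx::finite) + CARD('dy::finite)"
    and s: "s = real d / (real CARD('dx) / sX + real CARD('dy) / sY)"
  shows "\<exists>c1 c2 :: real. 0 < c1 \<and> 0 < c2 \<and>
    (\<forall>(n :: nat) (r :: real).
       1 \<le> n \<longrightarrow> 0 < r \<longrightarrow> 2 \<le> real n * r\<^sup>2 \<longrightarrow>
       (r ^ d / real n powr (2 * s)) powr (1 / (4 * s + real d))
          \<le> c1 / sqrt (ln (real n * r\<^sup>2)) \<longrightarrow>
       ennreal (c2 * (r ^ d / real n powr (2 * s)) powr (1 / (4 * s + real d)))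
          \<le> separation_radius n \<gamma>
              (sobolev_weight sX sY :: 'dx index \<Rightarrow> 'dy index \<Rightarrow> ennreal) r A)"
proof -
  define dX dY where "dX = CARD('dx)" and "dY = CARD('dy)"
  have dXY: "0 < dX" "0 < dY" "d = dX + dY" by (simp_all add: dX_def dY_def d)
  then have dpos: "0 < d" by simp
  define \<kappa> where "\<kappa> = real dX / sX + real dY / sY"
  have \<kappa>: "0 < \<kappa>" unfolding \<kappa>_def using assms dXY by (intro add_pos_pos divide_pos_pos) auto
  have s_eq: "s = real d / \<kappa>" by (simp add: s \<kappa>_def dX_def dY_def)
  have spos: "0 < s" and s\<kappa>: "real d / s = \<kappa>" using dXY \<kappa> by (simp_all add: s_eq)
  \<comment> \<open>\<open>b\<close>: sup-norm budget that keeps the density between 0 and \<open>A\<close>; \<open>\<tau>\<close>: loss in the risk, less than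
      \<open>1 - \<gamma>\<close>; \<open>\<delta>\<close>: fraction of discarded signs, chosen to cost half of the admissible \<open>\<tau>\<^sup>2\<close>; \<open>H\<close> and \<open>q\<close>:
      the grid needs at most \<open>H * u powr q\<close> points per axis when \<open>u = n * r\<^sup>2\<close>\<close>
  define b where "b = min 1 (A - 1)"
  define \<tau> where "\<tau> = (1 - \<gamma>) / 2"
  define \<delta> where "\<delta> = \<tau>\<^sup>2 / (2 * (1 + \<tau>\<^sup>2))"
  define C where "C = max ((2 * real dX) powr sX) ((2 * real dY) powr sY)"
  define q where "q = \<kappa> + 1 / sX + 1 / sY"
  define H where "H = 48 * pi * (2 ^ d * (2 * real d)) / b"
  have b: "0 < b" "b \<le> 1" "b \<le> A - 1" using assms by (auto simp: b_def)
  have \<tau>: "0 < \<tau>" using assms by (simp add: \<tau>_def)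
  have \<tau>2: "0 < 1 + \<tau>\<^sup>2" by (simp add: add_pos_nonneg)
  have \<delta>: "0 < \<delta>" "\<delta> < 1" "(1 + \<tau>\<^sup>2) * (1 - \<delta>) = 1 + \<tau>\<^sup>2 / 2"
    using \<tau> \<tau>2 by (simp_all add: \<delta>_def field_simps)
  have C: "0 < C" using dXY by (simp add: C_def less_max_iff_disj)
  have q: "0 < q" using \<kappa> assms by (simp add: q_def add_pos_pos)
  have H: "0 < H" using b dXY by (simp add: H_def)
  have ln\<tau>: "0 < ln (1 + \<tau>\<^sup>2 / 2)" using \<tau> by (intro ln_gt_zero) simp
  \<comment> \<open>\<open>E\<close> is the surplus in the exponent of \<open>u \<ge> 2\<close> that absorbs the constants of the union bound.\<close>
  obtain E where E: "2 * H ^ d / \<delta> < 2 ^ E" using real_arch_pow[of 2 "2 * H ^ d / \<delta>"] by auto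
  obtain c where c: "0 < c" "c \<le> 1" "C * c \<le> 1" "c ^ 4 / 2 \<le> ln (1 + \<tau>\<^sup>2 / 2)"
      "(32 * (q * real d + real E)) * c\<^sup>2 \<le> b\<^sup>2"
    using ln\<tau> b q C
    by - (rule small_constant_exists[of C "32 * (q * real d + real E)" "ln (1 + \<tau>\<^sup>2 / 2)" "b\<^sup>2"], auto)
  show ?thesis
  proof (rule exI[of _ 1], rule exI[of _ c], intro conjI allI impI)
    fix n :: nat and r :: real
    let ?u = "real n * r\<^sup>2"
    let ?R = "(r ^ d / real n powr (2 * s)) powr (1 / (4 * s + real d))"
    assume n: "1 \<le> n" and r: "0 < r" and u: "2 \<le> ?u" and R_le: "?R \<le> 1 / sqrt (ln ?u)"
    define u where "u = ?u"
    define R where "R = ?R"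
    define T where "T = u powr (2 * s / (4 * s + real d))"
    have u2: "2 \<le> u" using u by (simp add: u_def)
    have Rpos: "0 < R" using n r by (simp add: R_def)
    have ids: "R * T = r" "(real n)\<^sup>2 * R ^ 4 = T powr \<kappa>"
      using rate_identities[of "real n" r s "real d"] n r spos dpos
      by (simp_all add: R_def T_def u_def powr_realpow s\<kappa>)
    have T1: "1 \<le> T" unfolding T_def using u2 spos by (intro ge_one_powr_ge_zero) auto
    have "T \<le> u powr 1"
      unfolding T_def using u2 spos by (intro powr_mono) auto
    then have Tu: "T \<le> u" using u2 by simp
    have lnu: "0 < ln u" using u2 by simp
    \<comment> \<open>The hypothesis on the rate enters only in this form, made for the exponent in the union bound.\<close>
    have Rsq: "R\<^sup>2 * ln u \<le> 1"
    proof -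
      have "R * sqrt (ln u) \<le> 1" using R_le lnu by (simp add: R_def u_def pos_le_divide_eq)
      then have "(R * sqrt (ln u))\<^sup>2 \<le> 1" using Rpos lnu by (intro power_le_one) auto
      then show ?thesis using lnu by (simp add: power_mult_distrib)
    qed
    have R2: "R \<le> 2"
    proof (rule power2_le_imp_le)
      have "1 / 4 \<le> ln (2::real)" using ln_2_less_1 ln2_ge_two_thirds by linarith
      then have "1 / 4 \<le> ln u" using u2 by (smt (verit) ln_le_cancel_iff)
      then have "R\<^sup>2 * (1 / 4) \<le> R\<^sup>2 * ln u" by (intro mult_left_mono) auto
      then show "R\<^sup>2 \<le> 2\<^sup>2" using Rsq by simp
    qed simp
    define KX where "KX = nat \<lceil>T powr (1 / sX)\<rceil>"
    define KY where "KY = nat \<lceil>T powr (1 / sY)\<rceil>"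
    have TX: "1 \<le> T powr (1 / sX)" and TY: "1 \<le> T powr (1 / sY)"
      using T1 assms by (auto intro!: ge_one_powr_ge_zero)
    note KX = ceiling_between[OF TX, folded KX_def]
    note KY = ceiling_between[OF TY, folded KY_def]
    define I :: "('dx index \<times> 'dy index) set" where "I = positive_frequencies KX \<times> positive_frequencies KY"
    define N where "N = real (card I)"
    have N_eq: "N = real KX ^ dX * real KY ^ dY"
      by (simp add: N_def I_def card_cartesian_product card_positive_frequencies dX_def dY_def)
    have pw: "(T powr (1 / sX)) ^ dX * (T powr (1 / sY)) ^ dY = T powr \<kappa>"
      using T1 by (simp add: \<kappa>_def powr_powr powr_add flip: powr_realpow)
    have N_ge: "T powr \<kappa> \<le> N"
      unfolding N_eq pw[symmetric] using KX KY by (intro mult_mono power_mono) auto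
    have N1: "1 \<le> N" using N_ge ge_one_powr_ge_zero[OF T1, of \<kappa>] \<kappa> by linarith
    have "N \<le> (2 * T powr (1 / sX)) ^ dX * (2 * T powr (1 / sY)) ^ dY"
      unfolding N_eq using KX KY by (intro mult_mono power_mono) auto
    also have "\<dots> = 2 ^ d * T powr \<kappa>"
      by (simp add: power_mult_distrib pw[symmetric] dXY power_add)
    finally have N_le: "N \<le> 2 ^ d * T powr \<kappa>" .
    define m where "m = real dX * real KX + real dY * real KY"
    have m1: "1 \<le> m"
    proof -
      have "1 * 1 \<le> real dX * real KX" using dXY KX by (intro mult_mono) auto
      then show ?thesis unfolding m_def by (simp add: add_increasing2)
    qed
    have "m \<le> real dX * (2 * T powr (1 / sX + 1 / sY)) + real dY * (2 * T powr (1 / sX + 1 / sY))"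
      unfolding m_def
    proof (intro add_mono mult_left_mono)
      have "T powr (1 / sX) \<le> T powr (1 / sX + 1 / sY)" "T powr (1 / sY) \<le> T powr (1 / sX + 1 / sY)"
        using T1 assms by (auto intro!: powr_mono)
      then show "real KX \<le> 2 * T powr (1 / sX + 1 / sY)" "real KY \<le> 2 * T powr (1 / sX + 1 / sY)"
        using KX KY by linarith+
    qed auto
    also have "\<dots> = 2 * real d * T powr (1 / sX + 1 / sY)" by (simp add: dXY algebra_simps)
    finally have m_le: "m \<le> 2 * real d * T powr (1 / sX + 1 / sY)" .
    have "N * m \<le> (2 ^ d * T powr \<kappa>) * (2 * real d * T powr (1 / sX + 1 / sY))"
      using N1 m1 by (intro mult_mono N_le m_le) auto
    also have "\<dots> = 2 ^ d * (2 * real d) * T powr q"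
      by (simp add: q_def powr_add)
    also have "\<dots> \<le> 2 ^ d * (2 * real d) * u powr q"
      using T1 Tu q by (intro mult_left_mono powr_mono2) auto
    finally have Nm_le: "N * m \<le> 2 ^ d * (2 * real d) * u powr q" .
    define X where "X = 16 * pi * (N * m) / b"
    have X1: "1 \<le> X"
    proof -
      have "b \<le> 1 * (1 * 1)" using b by simp
      also have "\<dots> \<le> 16 * pi * (N * m)" using N1 m1 pi_gt3 by (intro mult_mono) auto
      finally show ?thesis using b by (simp add: X_def)
    qed
    have "X \<le> 16 * pi * (2 ^ d * (2 * real d) * u powr q) / b"
      unfolding X_def using b(1) by (intro divide_right_mono mult_left_mono Nm_le) simp_all
    also have "\<dots> = H * u powr q / 3" by (simp add: H_def)
    finally have X_le: "3 * X \<le> H * u powr q" by simp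
    define L where "L = nat \<lceil>X\<rceil>"
    note L = ceiling_between[OF X1, folded L_def]
    have L_le: "real (L + 1) \<le> H * u powr q" using L(2) X1 X_le by simp
    define \<eta> where "\<eta> = c * R / sqrt N"
    have \<eta>: "0 < \<eta>" using c Rpos N1 by (simp add: \<eta>_def)
    have \<eta>N: "\<eta>\<^sup>2 * N = (c * R)\<^sup>2" using N1 by (simp add: \<eta>_def power_divide)
    have risk: "ennreal (1 - \<tau>) \<le> minimax_risk n (sobolev_weight sX sY :: 'dx index \<Rightarrow> 'dy index \<Rightarrow> ennreal) r A \<rho>"
      if \<rho>: "0 < \<rho>" "\<rho> \<le> c * R" for \<rho>
    proof (rule minimax_risk_lower_bound[of I \<eta> L b \<tau> A _ "C * T" r \<rho> m \<delta> n])
      show "nonconstant_frequencies I"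
        unfolding I_def by unfold_locales
          (intro finite_cartesian_product finite_positive_frequencies, intro Sigma_mono positive_frequencies_subset)
      show "I \<noteq> {}" using N1 by (auto simp: N_def)
      show "0 \<le> C * T" using C T1 by simp
      show "sobolev_weight sX sY j k \<le> ennreal (C * T)" if "(j, k) \<in> I" for j k
        unfolding C_def dX_def dY_def using that assms KX KY T1
        by (intro sobolev_weight_positive_frequencies_le) (auto simp: I_def)
      show "(C * T)\<^sup>2 * (\<eta>\<^sup>2 * real (card I)) \<le> r\<^sup>2"
      proof -
        have "(C * T)\<^sup>2 * (\<eta>\<^sup>2 * real (card I)) = (C * c)\<^sup>2 * (R * T)\<^sup>2"
          using \<eta>N by (simp add: N_def power_mult_distrib)
        also have "\<dots> \<le> 1\<^sup>2 * (R * T)\<^sup>2"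
          using c C by (intro mult_right_mono power_mono) auto
        finally show ?thesis by (simp add: ids)
      qed
      show "\<rho>\<^sup>2 \<le> \<eta>\<^sup>2 * real (card I)"
        using \<eta>N \<rho> by (simp add: N_def power_mono)
      show "l1_norm (snd (fst i)) + l1_norm (snd (snd i)) \<le> m" if "i \<in> I" for i
        unfolding m_def dX_def dY_def using that
        by (intro add_mono l1_norm_positive_frequencies) (auto simp: I_def)
      \<comment> \<open>As \<open>N * \<eta> = c * R * sqrt N \<le> 2 * N\<close>, the choice of \<open>L\<close> suffices.\<close>
      show "real (card I) * \<eta> * (8 * pi * m) \<le> b * real L"
      proof -
        have "N * \<eta> = c * R * sqrt N" using N1 by (simp add: \<eta>_def real_div_sqrt field_simps)
        also have "\<dots> \<le> 1 * 2 * N"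
        proof (intro mult_mono)
          show "sqrt N \<le> N" using N1 by (intro real_le_lsqrt) (auto simp: power2_eq_square)
        qed (use c R2 Rpos N1 in auto)
        finally have "N * \<eta> * (8 * pi * m) \<le> 1 * 2 * N * (8 * pi * m)"
          using m1 by (intro mult_right_mono) auto
        also have "\<dots> = b * X" using b by (simp add: X_def)
        also have "\<dots> \<le> b * real L" using b L by (intro mult_left_mono) auto
        finally show ?thesis by (simp add: N_def)
      qed
      show "2 * real (L + 1) ^ (CARD('dx) + CARD('dy)) * exp (- b\<^sup>2 / (32 * (\<eta>\<^sup>2 * real (card I)))) \<le> \<delta>"
      proof -
        \<comment> \<open>The choice of \<open>c\<close> makes the Gaussian tail beat the \<open>d\<close>-th power of the grid size, as \<open>R\<^sup>2 * ln u \<le> 1\<close>.\<close>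
        have "- b\<^sup>2 / (32 * (c * R)\<^sup>2) \<le> - (q * real d + real E) * ln u"
        proof -
          have "(q * real d + real E) * ln u * (32 * (c * R)\<^sup>2)
              = (32 * (q * real d + real E) * c\<^sup>2) * (R\<^sup>2 * ln u)"
            by (simp add: power_mult_distrib)
          also have "\<dots> \<le> b\<^sup>2 * 1"
            using c Rsq lnu by (intro mult_mono) auto
          finally have "(q * real d + real E) * ln u \<le> b\<^sup>2 / (32 * (c * R)\<^sup>2)"
            using c Rpos by (subst pos_le_divide_eq) auto
          then show ?thesis by (simp only: minus_divide_left[symmetric] mult_minus_left neg_le_iff_le)
        qed
        then have "exp (- b\<^sup>2 / (32 * (c * R)\<^sup>2)) \<le> u powr (- (q * real d + real E))"
          using u2 by (simp add: powr_def)
        then have "2 * real (L + 1) ^ d * exp (- b\<^sup>2 / (32 * (c * R)\<^sup>2))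
            \<le> 2 * (H * u powr q) ^ d * u powr (- (q * real d + real E))"
          using L_le by (intro mult_mono power_mono) auto
        also have "\<dots> = 2 * H ^ d * u powr (- real E)"
        proof -
          have "(u powr q) ^ d = u powr (q * real d)" using u2 by (simp add: powr_powr flip: powr_realpow)
          then show ?thesis using u2 by (simp add: power_mult_distrib flip: powr_add)
        qed
        also have "\<dots> \<le> 2 * H ^ d * 2 powr (- real E)"
          using u2 H by (intro mult_left_mono powr_mono2') auto
        also have "\<dots> \<le> \<delta>"
          using E \<delta> by (simp add: powr_minus powr_realpow field_simps)
        finally show ?thesis using \<eta>N by (simp add: N_def d)
      qed
      show "exp ((real n * \<eta>\<^sup>2)\<^sup>2 * real (card I) / 2) \<le> (1 + \<tau>\<^sup>2) * (1 - \<delta>)"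
      proof -
        have "(real n * \<eta>\<^sup>2)\<^sup>2 * N = (real n)\<^sup>2 * (\<eta>\<^sup>2 * N)\<^sup>2 / N"
          using N1 by (simp add: power2_eq_square)
        also have "\<dots> = c ^ 4 * ((real n)\<^sup>2 * R ^ 4) / N"
          unfolding \<eta>N by (simp add: power_mult_distrib flip: power_mult)
        also have "\<dots> \<le> c ^ 4"
        proof -
          have "c ^ 4 * T powr \<kappa> \<le> c ^ 4 * N" using c N_ge by (intro mult_left_mono) auto
          then show ?thesis using N1 by (simp add: ids pos_divide_le_eq)
        qed
        finally have "(real n * \<eta>\<^sup>2)\<^sup>2 * N / 2 \<le> ln (1 + \<tau>\<^sup>2 / 2)" using c by linarith
        then have "exp ((real n * \<eta>\<^sup>2)\<^sup>2 * N / 2) \<le> exp (ln (1 + \<tau>\<^sup>2 / 2))" by simp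
        also have "\<dots> = (1 + \<tau>\<^sup>2) * (1 - \<delta>)" using \<tau> \<delta> by (simp add: add_pos_nonneg)
        finally show ?thesis by (simp add: N_def)
      qed
    qed (use \<eta> L b \<tau> \<delta> in auto)
    have strict: "ennreal \<gamma> < ennreal (1 - \<tau>)"
      using assms by (auto simp: \<tau>_def ennreal_less_iff field_simps)
    have "ennreal (c * R) \<le> separation_radius n \<gamma> (sobolev_weight sX sY :: 'dx index \<Rightarrow> 'dy index \<Rightarrow> ennreal) r A"
      by (rule separation_radius_geI) (rule less_le_trans[OF strict risk])
    then show "ennreal (c * ?R) \<le> separation_radius n \<gamma> (sobolev_weight sX sY :: 'dx index \<Rightarrow> 'dy index \<Rightarrow> ennreal) r A"
      by (simp only: R_def)
  qed (use c in auto)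
qed

end
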